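(* Let $\mathcal{Q}$ be a quaternion division algebra over a field $\mathbb{F}$, and let $u$ be an endomorphism of a right $\mathcal{Q}$-vector space $V$ with finite dimension $n\geq 3$. Assume that $u$ is of neither one of special types I, II and III. Then the following conditions are equivalent: (i) $\operatorname{tr}(u)=0$; (ii) $u$ is represented, in some basis of $V$, by a matrix with all diagonal entries zero; (iii) $u$ is the sum of two nilpotent endomorphisms of $V$.
   Context: $\mathbb{F}$ is an arbitrary field (characteristic $2$ allowed). A quaternion division algebra over $\mathbb{F}$ is a $4$-dimensional associative unital $\mathbb{F}$-algebra with center $\mathbb{F}$ that is a division ring. It carries the quaternionic conjugation $q\mapsto\overline{q}$, the unique involutory $\mathbb{F}$-linear antiautomorphism such that $q\overline{q}=\overline{q}q\in\mathbb{F}$ for all $q$; the reduced trace of $q$ is $t(q):=q+\overline{q}\in\mathbb{F}$. Vector spaces are right vector spaces; the matrix $(m_{i,j})$ of $u$ in a basis $(e_1,\dots,e_n)$ is given by $u(e_j)=\sum_i e_i m_{i,j}$. The reduced trace of a square matrix $A$ over $\mathcal{Q}$ is $\operatorname{tr}(A):=t(\operatorname{Tr}(A))\in\mathbb{F}$, where $\operatorname{Tr}(A)$ is the sum of the diagonal entries of $A$. It is invariant under similarity, and $\operatorname{tr}(u)$ is defined as $\operatorname{tr}(A)$ for any matrix $A$ representing $u$. An eigenvalue of $u$ is a $q\in\mathcal{Q}$ for which there is a nonzero vector $x$ (an eigenvector) with $u(x)=xq$. The set of eigenvalues is a union of conjugacy classes of $\mathcal{Q}$; $u$ is unispectral if its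 eigenvalues form exactly one conjugacy class. $u$ is diagonalisable if $V$ has a basis of eigenvectors of $u$. For $\lambda\in\mathbb{F}$, $\operatorname{id}_V\lambda$ is the endomorphism $x\mapsto x\lambda$. Special type I: $u=\operatorname{id}_V\lambda$ for some nonzero $\lambda\in\mathbb{F}$. Special type II: $\dim V\geq 2$ and $u=\operatorname{id}_V\lambda+a$ for some $\lambda\in\mathbb{F}$ and some endomorphism $a$ of $V$ of rank $1$. Special type III: $\dim V=3$ and $u$ is unispectral, diagonalisable and nonzero. *)

theory Defs
  imports Complex_Main
begin

section \<open>Quaternion division algebras\<close>

text \<open>The field acts on the algebra by \<open>scale\<close>; its copy inside the algebra is
  \<open>range (\<lambda>c. scale c 1)\<close>. Since \<^const>\<open>vector_space.dim\<close> is \<open>0\<close> in infinite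
  dimension, \<open>dim_4\<close> includes finite-dimensionality.\<close>

locale quaternion_division_algebra = vector_space scale
  for scale :: "'f::field \<Rightarrow> 'q::division_ring \<Rightarrow> 'q" +
  assumes scale_mult_left: "scale c (p * q) = scale c p * q"
    and scale_mult_right: "scale c (p * q) = p * scale c q"
    and dim_4: "dim UNIV = 4"
    and center: "{z. \<forall>q. z * q = q * z} = range (\<lambda>c. scale c 1)"

text \<open>An involutory map is bijective, so \<open>\<sigma>\<close> below is an antiautomorphism.\<close>

definition is_quaternion_conjugation ::
    "('f::field \<Rightarrow> 'q::division_ring \<Rightarrow> 'q) \<Rightarrow> ('q \<Rightarrow> 'q) \<Rightarrow> bool" where
  "is_quaternion_conjugation scale \<sigma> \<longleftrightarrow>
     Vector_Spaces.linear scale scale \<sigma> \<and>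
     (\<forall>p q. \<sigma> (p * q) = \<sigma> q * \<sigma> p) \<and>
     (\<forall>q. \<sigma> (\<sigma> q) = q) \<and>
     (\<forall>q. q * \<sigma> q = \<sigma> q * q \<and> q * \<sigma> q \<in> range (\<lambda>c. scale c 1))"

definition qconj :: "('f::field \<Rightarrow> 'q::division_ring \<Rightarrow> 'q) \<Rightarrow> 'q \<Rightarrow> 'q" where
  "qconj scale = (THE \<sigma>. is_quaternion_conjugation scale \<sigma>)"

text \<open>Reduced traces lie in the copy of the field inside the algebra, and are kept as
  elements of the algebra.\<close>

definition reduced_trace :: "('f::field \<Rightarrow> 'q::division_ring \<Rightarrow> 'q) \<Rightarrow> 'q \<Rightarrow> 'q" where
  "reduced_trace scale q = q + qconj scale q"

definition conjugacy_class :: "'q::division_ring \<Rightarrow> 'q set" where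
  "conjugacy_class q = {p * q * inverse p | p. p \<noteq> 0}"


section \<open>Right vector spaces over a division ring\<close>

text \<open>The library's modules and vector spaces have commutative scalars, hence the
  definitions below. Families of \<open>n\<close> vectors are functions on \<open>nat\<close> of which only the values
  at \<open>i < n\<close> matter; likewise for \<open>n \<times> n\<close> matrices.\<close>

locale right_vector_space =
  fixes act :: "'v::ab_group_add \<Rightarrow> 'q::division_ring \<Rightarrow> 'v"
  assumes act_add_left: "act (x + y) q = act x q + act y q"
    and act_add_right: "act x (p + q) = act x p + act x q"
    and act_mult: "act x (p * q) = act (act x p) q"
    and act_one: "act x 1 = x"

definition endomorphism ::
    "('v::ab_group_add \<Rightarrow> 'q::division_ring \<Rightarrow> 'v) \<Rightarrow> ('v \<Rightarrow> 'v) \<Rightarrow> bool" where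
  "endomorphism act u \<longleftrightarrow>
     (\<forall>x y. u (x + y) = u x + u y) \<and> (\<forall>x q. u (act x q) = act (u x) q)"

definition family_span ::
    "('v::ab_group_add \<Rightarrow> 'q::division_ring \<Rightarrow> 'v) \<Rightarrow> nat \<Rightarrow> (nat \<Rightarrow> 'v) \<Rightarrow> 'v set" where
  "family_span act n e = {\<Sum>i<n. act (e i) (c i) | c. True}"

definition family_independent ::
    "('v::ab_group_add \<Rightarrow> 'q::division_ring \<Rightarrow> 'v) \<Rightarrow> nat \<Rightarrow> (nat \<Rightarrow> 'v) \<Rightarrow> bool" where
  "family_independent act n e \<longleftrightarrow>
     (\<forall>c. (\<Sum>i<n. act (e i) (c i)) = 0 \<longrightarrow> (\<forall>i<n. c i = 0))"

definition is_basis ::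
    "('v::ab_group_add \<Rightarrow> 'q::division_ring \<Rightarrow> 'v) \<Rightarrow> 'v set \<Rightarrow> nat \<Rightarrow> (nat \<Rightarrow> 'v) \<Rightarrow> bool" where
  "is_basis act W n e \<longleftrightarrow> family_independent act n e \<and> family_span act n e = W"

definition has_dim ::
    "('v::ab_group_add \<Rightarrow> 'q::division_ring \<Rightarrow> 'v) \<Rightarrow> 'v set \<Rightarrow> nat \<Rightarrow> bool" where
  "has_dim act W n \<longleftrightarrow> (\<exists>e. is_basis act W n e)"

definition has_rank ::
    "('v::ab_group_add \<Rightarrow> 'q::division_ring \<Rightarrow> 'v) \<Rightarrow> ('v \<Rightarrow> 'v) \<Rightarrow> nat \<Rightarrow> bool" where
  "has_rank act a r \<longleftrightarrow> has_dim act (range a) r"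

definition represented_by ::
    "('v::ab_group_add \<Rightarrow> 'q::division_ring \<Rightarrow> 'v) \<Rightarrow> ('v \<Rightarrow> 'v) \<Rightarrow> nat \<Rightarrow> (nat \<Rightarrow> 'v) \<Rightarrow>
      (nat \<Rightarrow> nat \<Rightarrow> 'q) \<Rightarrow> bool" where
  "represented_by act u n e M \<longleftrightarrow>
     is_basis act UNIV n e \<and> (\<forall>j<n. u (e j) = (\<Sum>i<n. act (e i) (M i j)))"

definition nilpotent :: "('v::zero \<Rightarrow> 'v) \<Rightarrow> bool" where
  "nilpotent a \<longleftrightarrow> (\<exists>k::nat. a ^^ k = (\<lambda>x. 0))"


section \<open>Reduced trace and spectrum of an endomorphism\<close>

definition matrix_reduced_trace ::
    "('f::field \<Rightarrow> 'q::division_ring \<Rightarrow> 'q) \<Rightarrow> nat \<Rightarrow> (nat \<Rightarrow> nat \<Rightarrow> 'q) \<Rightarrow> 'q" where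
  "matrix_reduced_trace scale n M = reduced_trace scale (\<Sum>i<n. M i i)"

text \<open>All matrices representing \<open>u\<close> have the same reduced trace.\<close>

definition endo_reduced_trace ::
    "('f::field \<Rightarrow> 'q::division_ring \<Rightarrow> 'q) \<Rightarrow> ('v::ab_group_add \<Rightarrow> 'q \<Rightarrow> 'v) \<Rightarrow>
      ('v \<Rightarrow> 'v) \<Rightarrow> 'q" where
  "endo_reduced_trace scale act u =
     (THE t. \<exists>n e M. represented_by act u n e M \<and> t = matrix_reduced_trace scale n M)"

definition is_eigenvector ::
    "('v::ab_group_add \<Rightarrow> 'q::division_ring \<Rightarrow> 'v) \<Rightarrow> ('v \<Rightarrow> 'v) \<Rightarrow> 'q \<Rightarrow> 'v \<Rightarrow> bool" where
  "is_eigenvector act u q x \<longleftrightarrow> x \<noteq> 0 \<and> u x = act x q"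

definition eigenvalues ::
    "('v::ab_group_add \<Rightarrow> 'q::division_ring \<Rightarrow> 'v) \<Rightarrow> ('v \<Rightarrow> 'v) \<Rightarrow> 'q set" where
  "eigenvalues act u = {q. \<exists>x. is_eigenvector act u q x}"

definition unispectral ::
    "('v::ab_group_add \<Rightarrow> 'q::division_ring \<Rightarrow> 'v) \<Rightarrow> ('v \<Rightarrow> 'v) \<Rightarrow> bool" where
  "unispectral act u \<longleftrightarrow> (\<exists>q. eigenvalues act u = conjugacy_class q)"

definition diagonalisable ::
    "('v::ab_group_add \<Rightarrow> 'q::division_ring \<Rightarrow> 'v) \<Rightarrow> ('v \<Rightarrow> 'v) \<Rightarrow> bool" where
  "diagonalisable act u \<longleftrightarrow>
     (\<exists>n e. is_basis act UNIV n e \<and> (\<forall>i<n. \<exists>q. is_eigenvector act u q (e i)))"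


section \<open>Special types\<close>

definition scalar_endo ::
    "('f::field \<Rightarrow> 'q::division_ring \<Rightarrow> 'q) \<Rightarrow> ('v::ab_group_add \<Rightarrow> 'q \<Rightarrow> 'v) \<Rightarrow>
      'f \<Rightarrow> 'v \<Rightarrow> 'v" where
  "scalar_endo scale act c = (\<lambda>x. act x (scale c 1))"

definition special_type_I ::
    "('f::field \<Rightarrow> 'q::division_ring \<Rightarrow> 'q) \<Rightarrow> ('v::ab_group_add \<Rightarrow> 'q \<Rightarrow> 'v) \<Rightarrow>
      ('v \<Rightarrow> 'v) \<Rightarrow> bool" where
  "special_type_I scale act u \<longleftrightarrow> (\<exists>c. c \<noteq> 0 \<and> u = scalar_endo scale act c)"

definition special_type_II ::
    "('f::field \<Rightarrow> 'q::division_ring \<Rightarrow> 'q) \<Rightarrow> ('v::ab_group_add \<Rightarrow> 'q \<Rightarrow> 'v) \<Rightarrow>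
      ('v \<Rightarrow> 'v) \<Rightarrow> bool" where
  "special_type_II scale act u \<longleftrightarrow>
     (\<exists>n\<ge>2. has_dim act UNIV n) \<and>
     (\<exists>c a. endomorphism act a \<and> has_rank act a 1 \<and> u = (\<lambda>x. scalar_endo scale act c x + a x))"

definition special_type_III ::
    "('v::ab_group_add \<Rightarrow> 'q::division_ring \<Rightarrow> 'v) \<Rightarrow> ('v \<Rightarrow> 'v) \<Rightarrow> bool" where
  "special_type_III act u \<longleftrightarrow>
     has_dim act UNIV 3 \<and> unispectral act u \<and> diagonalisable act u \<and> u \<noteq> (\<lambda>x. 0)"

end

(* The implications (ii) => (iii) => (i) are formal: a matrix with zero diagonal is the sum of a
   strictly upper and a strictly lower triangular one, and a nilpotent endomorphism has reduced
   trace zero by induction on the dimension.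

   For (i) => (ii), suppose first that some x, u x, u (u x) are independent. If n >= 4, a basis
   starting with such a vector can be rearranged so that the first diagonal entry vanishes and the
   compression of u to the span of the remaining vectors again has a cyclic triple; so one is
   reduced to n = 3. There the only remaining diagonal entry c has reduced trace zero, hence is of
   the form k^-1 p k - p, and this is used to make it vanish by a change of basis.

   If there is no such x, two cases remain. When n >= 4 and some x, u x, y, u y are independent,
   one compression along x produces a cyclic triple. Otherwise u is a central scalar plus a map of
   rank at most one, or n = 3 and, in some basis, u is the diagonal matrix with a single quaternion
   repeated on the diagonal; apart from u = 0 these are the special types. *)
theory Submission
  imports Defs
begin

text \<open>Noncommutativity creates two obstacles: a diagonal entry of reduced trace zero need not
  vanish, and the scalar attached to an invariant line is determined only up to conjugacy. Two facts
  about quaternions deal with them. Noncentral elements with equal trace and norm are conjugate, so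
  an element of trace zero is a difference of two conjugates; this clears the last diagonal entry in
  dimension 3. And a commutator \<open>d * r - r * d\<close> intertwines \<open>d\<close> with
  \<open>cj d\<close>; in the degenerate case of dimension 3, an eigenvector relation valid for a
  whole family of vectors thereby forces the eigenvalue \<open>cj \<delta>\<close>, and the entries
  above the diagonal become commutators. The induction carries a cyclic triple, not the absence of
  special types, because a compression of a non-special map may well be special, whereas no special
  map has a cyclic triple. Characteristic 2 rules out splitting off the trace by halving;
  conjugation is therefore built from the quadratic equation of each element.\<close>

section \<open>Conjugation and reduced trace\<close>

context quaternion_division_algebra
begin

text \<open>With the field seen as a central subset, scalars are handled by the multiplication of
  the algebra instead of by \<open>scale\<close>.\<close>

definition Z :: "'q set" where
  "Z = range (\<lambda>c. scale c 1)"

lemma Z_iff: "z \<in> Z \<longleftrightarrow> (\<forall>q. z * q = q * z)"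
  unfolding Z_def using center by auto

lemma Z_commute: "z \<in> Z \<Longrightarrow> z * q = q * z"
  by (simp add: Z_iff)

lemma Z_left_commute: "z \<in> Z \<Longrightarrow> p * (z * q) = z * (p * q)"
  by (metis Z_commute mult.assoc)

lemma Z_left_commute': "z \<in> Z \<Longrightarrow> z * (p * q) = p * (z * q)"
  by (metis Z_commute mult.assoc)

lemmas Z_ac = Z_commute Z_left_commute Z_left_commute'

lemma Z_add: "a \<in> Z \<Longrightarrow> b \<in> Z \<Longrightarrow> a + b \<in> Z"
  and Z_diff: "a \<in> Z \<Longrightarrow> b \<in> Z \<Longrightarrow> a - b \<in> Z"
  and Z_minus: "a \<in> Z \<Longrightarrow> - a \<in> Z"
  and Z_0: "0 \<in> Z" and Z_1: "1 \<in> Z"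
  by (simp_all add: Z_iff algebra_simps)

lemma Z_mult: "a \<in> Z \<Longrightarrow> b \<in> Z \<Longrightarrow> a * b \<in> Z"
  unfolding Z_iff by (metis mult.assoc)

lemma Z_inverse:
  assumes "a \<in> Z"
  shows "inverse a \<in> Z"
proof (cases "a = 0")
  case False
  have "inverse a * q = q * inverse a" for q
  proof -
    have "inverse a * q = inverse a * (q * a) * inverse a"
      using False by (simp add: mult.assoc)
    also have "q * a = a * q"
      using assms by (simp add: Z_iff)
    also have "inverse a * (a * q) * inverse a = q * inverse a"
      using False by (simp flip: mult.assoc)
    finally show ?thesis .
  qed
  then show ?thesis by (simp add: Z_iff)
qed (use assms in simp)

lemmas Z_closed = Z_add Z_diff Z_minus Z_0 Z_1 Z_mult Z_inverse

lemma Z_cancel: "z \<in> Z \<Longrightarrow> z \<noteq> 0 \<Longrightarrow> z * q \<in> Z \<Longrightarrow> q \<in> Z"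
  using Z_mult[of "inverse z" "z * q"] Z_inverse[of z]
  by (simp add: mult.assoc[symmetric])

lemma Z_not_add: "z \<in> Z \<Longrightarrow> z + q \<in> Z \<longleftrightarrow> q \<in> Z"
  by (metis Z_add Z_diff add_diff_cancel_left')

lemma scale_eq_mult: "scale c q = scale c 1 * q"
  by (metis scale_mult_left mult_1)

lemma scale_one_Z: "scale c 1 \<in> Z"
  by (auto simp: Z_def)

section \<open>Finite dimension over the centre, and centralisers\<close>

lemma finite_dimensional: "\<exists>B. finite_dimensional_vector_space scale B"
proof -
  obtain B where B: "independent B" "UNIV \<subseteq> span B" "card B = dim UNIV"
    using basis_exists[of UNIV] by metis
  have "finite B"
    using B(3) dim_4 card_gt_0_iff[of B] by simp
  then have "finite_dimensional_vector_space scale B"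
    by unfold_locales (use B in auto)
  then show ?thesis ..
qed

lemma span_eq_UNIV:
  assumes "independent A" "card A = 4"
  shows "span A = UNIV"
proof -
  obtain B where "finite_dimensional_vector_space scale B"
    using finite_dimensional ..
  then interpret fd: finite_dimensional_vector_space scale B .
  show ?thesis
    using fd.card_ge_dim_independent[of A UNIV] assms dim_4 by auto
qed

lemma linearI_Z:
  fixes f :: "'q \<Rightarrow> 'q"
  assumes add: "\<And>x y. f (x + y) = f x + f y"
    and Zmult: "\<And>z x. z \<in> Z \<Longrightarrow> f (z * x) = z * f x"
  shows "Vector_Spaces.linear scale scale f"
proof -
  have "f (scale c x) = scale c (f x)" for c x
    using Zmult[OF scale_one_Z, of c x]
    by (simp only: scale_eq_mult[of c x, symmetric] scale_eq_mult[of c "f x", symmetric])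
  then show ?thesis
    unfolding Vector_Spaces.linear_iff using vector_space_axioms add by blast
qed

text \<open>Linearity over the centre is linearity over the field, and the dimension is finite. This
  will solve a quadratic equation with quaternion coefficients on both sides, in
  \<open>not_cyclic3_special\<close>.\<close>

lemma injective_imp_surjective:
  fixes f :: "'q \<Rightarrow> 'q"
  assumes add: "\<And>x y. f (x + y) = f x + f y"
    and Zmult: "\<And>z x. z \<in> Z \<Longrightarrow> f (z * x) = z * f x"
    and ker: "\<And>x. f x = 0 \<Longrightarrow> x = 0"
  shows "surj f"
proof -
  obtain B where "finite_dimensional_vector_space scale B"
    using finite_dimensional ..
  then interpret fd: finite_dimensional_vector_space scale B .
  have lin: "Vector_Spaces.linear scale scale f"
    using add Zmult by (rule linearI_Z)
  interpret lin: Vector_Spaces.linear scale scale f by (fact lin)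
  have "inj f"
    using ker by (simp add: lin.inj_iff_eq_0)
  with lin show ?thesis by (rule fd.linear_inj_imp_surj)
qed

lemma span_one: "span {1} = Z"
  by (simp add: span_singleton Z_def)

lemma span_one_insert: "x \<in> span {a, 1} \<longleftrightarrow> (\<exists>u\<in>Z. \<exists>v\<in>Z. x = u + v * a)"
proof -
  have "x \<in> span {a, 1} \<longleftrightarrow> (\<exists>k. x - scale k a \<in> Z)"
    by (simp add: span_breakdown_eq[of x a "{1}"] span_one)
  also have "\<dots> \<longleftrightarrow> (\<exists>v\<in>Z. x - v * a \<in> Z)"
    unfolding Z_def using scale_eq_mult[of _ a] by auto
  also have "\<dots> \<longleftrightarrow> (\<exists>u\<in>Z. \<exists>v\<in>Z. x = u + v * a)"
    by (metis add_diff_cancel_right' diff_add_cancel)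
  finally show ?thesis .
qed

text \<open>If \<open>1, a, b\<close> were independent, a basis \<open>1, a, b, r\<close> would give \<open>r * (a - k)\<close>
  in the centraliser of \<open>a\<close> for some central \<open>k\<close>, and then \<open>r\<close> would commute with \<open>a\<close>.\<close>

lemma centraliser:
  assumes a: "a \<notin> Z" and ab: "a * b = b * a"
  shows "\<exists>x\<in>Z. \<exists>y\<in>Z. b = x + y * a"
proof (rule ccontr)
  assume "\<not> ?thesis"
  then have b: "b \<notin> span {a, 1}"
    by (simp add: span_one_insert)
  obtain r where r: "a * r \<noteq> r * a"
    using a Z_iff by blast
  have comm: "a * x = x * a" if "x \<in> span {b, a, 1}" for x
    using that
  proof (induction rule: span_induct_alt)
    case base
    show ?case by simp
  next
    case (step c y x)
    then show ?case
      using ab by (auto simp: distrib_left distrib_right simp flip: scale_mult_left scale_mult_right)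
  qed
  have ind: "independent {r, b, a, 1}"
  proof (intro independent_insertI)
    show "r \<notin> span {b, a, 1}" using comm r by blast
    show "b \<notin> span {a, 1}" by (fact b)
    show "a \<notin> span {1}" using a by (simp add: span_one)
    show "1 \<notin> span {}" by simp
    show "independent {}" by (rule independent_empty)
  qed
  have "r \<notin> {b, a, 1}" "b \<notin> {a, 1}" "a \<noteq> 1"
    using r b ab span_base[of b "{a, 1}"] a Z_1 by auto
  then have "card {r, b, a, 1} = 4" by simp
  with ind have "r * a \<in> span {r, b, a, 1}"
    by (simp add: span_eq_UNIV)
  then obtain k where k: "r * a - scale k r \<in> span {b, a, 1}"
    by (metis span_breakdown_eq)
  define z where "z = scale k 1"
  have z: "z \<in> Z" by (simp add: z_def scale_one_Z)
  have "r * a - scale k r = r * (a - z)"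
    using z by (simp add: right_diff_distrib z_def Z_commute flip: scale_eq_mult)
       (metis Z_commute z z_def scale_eq_mult)
  with comm[OF k] have "a * (r * (a - z)) = r * (a - z) * a" by simp
  also have "\<dots> = r * a * (a - z)"
    using z by (simp add: right_diff_distrib left_diff_distrib mult.assoc Z_commute)
  finally have "(a * r - r * a) * (a - z) = 0"
    by (simp add: left_diff_distrib mult.assoc)
  moreover have "a - z \<noteq> 0" using a z by auto
  ultimately show False using r by simp
qed

section \<open>The quadratic equation of an element, its trace and its conjugate\<close>

lemma quadratic: "\<exists>s\<in>Z. q * q - s * q \<in> Z"
proof (cases "q \<in> Z")
  case True
  then show ?thesis by (intro bexI[of _ q]) (auto simp: Z_0)
next
  case False
  \<comment> \<open>\<open>q * q\<close> commutes with \<open>q\<close>, so it is a central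
    combination of \<open>1\<close> and \<open>q\<close>.\<close>
  then obtain x y where "x \<in> Z" "y \<in> Z" "q * q = x + y * q"
    using centraliser[of q "q * q"] by (auto simp: mult.assoc)
  then show ?thesis by (intro bexI[of _ y]) auto
qed

lemma quadratic_unique:
  assumes "q \<notin> Z" "s \<in> Z" "q * q - s * q \<in> Z" "s' \<in> Z" "q * q - s' * q \<in> Z"
  shows "s = s'"
proof (rule ccontr)
  assume "s \<noteq> s'"
  have "(q * q - s' * q) - (q * q - s * q) \<in> Z"
    using assms Z_diff by blast
  then have "(s - s') * q \<in> Z" by (simp add: algebra_simps)
  with \<open>s \<noteq> s'\<close> assms show False using Z_cancel[of "s - s'" q] Z_diff by auto
qed

text \<open>On the centre the quadratic equation does not determine the trace.\<close>

definition tq :: "'q \<Rightarrow> 'q" where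
  "tq q = (if q \<in> Z then q + q else (THE s. s \<in> Z \<and> q * q - s * q \<in> Z))"

definition cj :: "'q \<Rightarrow> 'q" where
  "cj q = tq q - q"

lemma tq_eqI: "q \<notin> Z \<Longrightarrow> s \<in> Z \<Longrightarrow> q * q - s * q \<in> Z \<Longrightarrow> tq q = s"
  unfolding tq_def using quadratic_unique[of q] by auto

lemma tq_Z: "tq q \<in> Z"
  and tq_quadratic: "q * q - tq q * q \<in> Z"
proof -
  have "tq q \<in> Z \<and> q * q - tq q * q \<in> Z"
  proof (cases "q \<in> Z")
    case True
    then show ?thesis by (simp add: tq_def Z_closed)
  next
    case False
    then show ?thesis using quadratic[of q] tq_eqI[of q] by auto
  qed
  then show "tq q \<in> Z" "q * q - tq q * q \<in> Z" by auto
qed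

lemma tq_on_Z: "z \<in> Z \<Longrightarrow> tq z = z + z"
  by (simp add: tq_def)

lemma tq_add_Z:
  assumes z: "z \<in> Z"
  shows "tq (z + q) = z + z + tq q"
proof (cases "q \<in> Z")
  case True
  with z show ?thesis by (simp add: tq_on_Z Z_add algebra_simps)
next
  case False
  have "(z + q) * (z + q) - (z + z + tq q) * (z + q) = (q * q - tq q * q) - z * z - tq q * z"
    using z by (simp add: algebra_simps Z_ac)
  also have "\<dots> \<in> Z"
    by (intro Z_diff Z_mult z tq_Z tq_quadratic)
  finally show ?thesis
    using False z tq_Z[of q] by (intro tq_eqI) (auto simp: Z_not_add Z_closed)
qed

lemma tq_mult_Z:
  assumes z: "z \<in> Z"
  shows "tq (z * q) = z * tq q"
proof (cases "q \<in> Z \<or> z = 0")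
  case True
  with z show ?thesis by (auto simp: tq_on_Z Z_mult Z_0 distrib_left)
next
  case False
  have "(z * q) * (z * q) - (z * tq q) * (z * q) = z * z * (q * q - tq q * q)"
    using z tq_Z[of q] by (simp add: algebra_simps Z_ac)
  also have "\<dots> \<in> Z"
    by (intro Z_mult z tq_quadratic)
  finally show ?thesis
    using False z tq_Z[of q] by (intro tq_eqI) (auto simp: Z_mult dest: Z_cancel)
qed

text \<open>The two sides differ by the commutator of \<open>r\<close> with
  \<open>a * a - tq a * a\<close>, which is central.\<close>

lemma commutator_cj: "(a * r - r * a) * a = cj a * (a * r - r * a)"
proof -
  have m: "a * a - tq a * a \<in> Z" by (rule tq_quadratic)
  have "cj a * (a * r - r * a) - (a * r - r * a) * a
      = r * (a * a - tq a * a) - (a * a - tq a * a) * r"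
    using tq_Z[of a] unfolding cj_def
    by (simp add: algebra_simps Z_ac)
  with m show ?thesis by (simp add: Z_commute)
qed

lemma commutator_cj': "a * (a * r - r * a) = (a * r - r * a) * cj a"
proof -
  let ?k = "a * r - r * a"
  have "?k * cj a = tq a * ?k - ?k * a"
    using Z_commute[OF tq_Z[of a], of ?k] by (simp add: cj_def right_diff_distrib)
  also have "\<dots> = (tq a - cj a) * ?k"
    using commutator_cj[of a r] by (simp only: left_diff_distrib[of "tq a"])
  finally show ?thesis by (simp add: cj_def)
qed

text \<open>For non-commuting \<open>a\<close> and \<open>b\<close>, conjugation of \<open>a\<close>, \<open>b\<close> and \<open>a + b\<close> is conjugation
  by one and the same element, their commutator.\<close>

lemma cj_add: "cj (a + b) = cj a + cj b"
proof (cases "a * b = b * a")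
  case False
  let ?k = "a * b - b * a"
  have "?k * a = cj a * ?k" by (rule commutator_cj)
  moreover have "?k * b = cj b * ?k"
    using commutator_cj[of b a] by (simp add: algebra_simps)
  moreover have "?k * (a + b) = cj (a + b) * ?k"
    using commutator_cj[of "a + b" b] by (simp add: algebra_simps)
  ultimately have "(cj (a + b) - (cj a + cj b)) * ?k = 0"
    by (simp add: left_diff_distrib distrib_right distrib_left)
  with False show ?thesis by simp
next
  case True
  have "tq (a + b) = tq a + tq b"
  proof (cases "a \<in> Z")
    case True
    then show ?thesis by (simp add: tq_add_Z tq_on_Z)
  next
    case False
    with True obtain x y where xy: "x \<in> Z" "y \<in> Z" "b = x + y * a"
      using centraliser[of a b] by blast
    have ab: "a + b = x + (1 + y) * a" by (simp add: xy algebra_simps)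
    show ?thesis
      unfolding ab using xy(1,2)
      by (simp add: tq_add_Z tq_mult_Z Z_closed tq_on_Z) (simp add: xy(3) tq_add_Z tq_mult_Z xy(1,2) algebra_simps)
  qed
  then show ?thesis by (simp add: cj_def)
qed

lemma tq_add: "tq (a + b) = tq a + tq b"
  using cj_add[of a b] by (simp add: cj_def)

lemma cj_on_Z: "z \<in> Z \<Longrightarrow> cj z = z"
  by (simp add: cj_def tq_on_Z)

lemma cj_mult_Z: "z \<in> Z \<Longrightarrow> cj (z * q) = z * cj q"
  by (simp add: cj_def tq_mult_Z right_diff_distrib)

lemma cj_cj: "cj (cj q) = q"
proof -
  have "tq (tq q + (- 1) * q) = tq q + tq q + (- 1) * tq q"
    by (simp only: tq_add_Z[OF tq_Z] tq_mult_Z[OF Z_minus[OF Z_1]])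
  then show ?thesis by (simp add: cj_def)
qed

lemma norm_Z: "q * cj q \<in> Z"
  using Z_minus[OF tq_quadratic[of q]] tq_Z[of q] by (simp add: cj_def algebra_simps Z_ac)

lemma cj_commute: "cj q * q = q * cj q"
  using tq_Z[of q] by (simp add: cj_def algebra_simps Z_ac)

text \<open>Both the sum and the product of \<open>p * q\<close> and \<open>cj q * cj p\<close> are
  central, so the sum is the trace of \<open>p * q\<close> as soon as the quadratic equation
  determines it, that is, for noncentral \<open>p * q\<close>.\<close>

lemma cj_mult: "cj (p * q) = cj q * cj p"
proof -
  define w where "w = cj q * cj p"
  have np: "p * cj p \<in> Z" and nq: "q * cj q \<in> Z" by (rule norm_Z)+
  have pqw: "p * q * w = (p * cj p) * (q * cj q)"
    unfolding w_def using nq by (metis Z_commute mult.assoc)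
  have sum: "p * q + w \<in> Z"
  proof -
    \<comment> \<open>Polarisation of the quadratic equation: compare those of \<open>p + q\<close>,
      \<open>p\<close> and \<open>q\<close>.\<close>
    have eq: "p * q + w = ((p + q) * (p + q) - tq (p + q) * (p + q))
        - (p * p - tq p * p) - (q * q - tq q * q) + tq q * tq p"
      using tq_Z[of p] tq_Z[of q]
      by (simp add: w_def cj_def tq_add algebra_simps Z_ac)
    show ?thesis
      unfolding eq by (intro Z_add Z_diff Z_mult tq_Z tq_quadratic)
  qed
  show ?thesis
  proof (cases "p * q \<in> Z")
    case False
    have "p * q * (p * q) - (p * q + w) * (p * q) = - (w * (p * q))"
      by (simp add: algebra_simps)
    also have "w * (p * q) = (p * q + w) * (p * q) - p * q * (p * q)"
      by (simp add: algebra_simps)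
    also have "\<dots> = p * q * w"
      unfolding Z_commute[OF sum, of "p * q"] by (simp add: algebra_simps)
    finally have "p * q * (p * q) - (p * q + w) * (p * q) = - (p * q * w)" .
    then have "tq (p * q) = p * q + w"
      using False sum np nq by (intro tq_eqI) (auto simp: pqw Z_closed)
    then show ?thesis by (simp add: cj_def w_def)
  next
    case True
    show ?thesis
    proof (cases "q = 0")
      case q: True
      then show ?thesis by (simp add: cj_on_Z Z_0)
    next
      case q: False
      have "cj q \<noteq> 0" using q cj_cj[of q] cj_on_Z[OF Z_0] by auto
      then have n0: "q * cj q \<noteq> 0" using q by simp
      \<comment> \<open>Here \<open>p * q\<close> is central. Conjugating both sides of this
        identity needs only multiplication by central elements, and it determines
        \<open>cj p\<close>.\<close>
      have "p * (q * cj q) = (p * q) * cj q" by (simp add: mult.assoc)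
      then have "p * (q * cj q) = (q * cj q) * p" "cj ((q * cj q) * p) = cj (p * q * cj q)"
        using nq by (auto simp: Z_commute)
      then have "(q * cj q) * cj p = (p * q) * q"
        using nq True cj_mult_Z[of "p * q" "cj q"] cj_mult_Z[of "q * cj q" p]
        by (simp add: cj_cj)
      then have "q * (cj q * cj p) = q * (p * q)"
        using True by (simp add: mult.assoc Z_left_commute Z_commute) (metis True Z_commute mult.assoc)
      then show ?thesis using q True by (simp add: cj_on_Z)
    qed
  qed
qed

lemma is_quaternion_conjugation_cj: "is_quaternion_conjugation scale cj"
proof -
  have "Vector_Spaces.linear scale scale cj"
    using cj_add cj_mult_Z by (rule linearI_Z)
  then show ?thesis
    unfolding is_quaternion_conjugation_def
    using cj_mult cj_cj cj_commute norm_Z by (auto simp: Z_def)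
qed

lemma is_quaternion_conjugation_unique:
  assumes "is_quaternion_conjugation scale \<sigma>"
  shows "\<sigma> = cj"
proof
  fix q
  have lin: "Vector_Spaces.linear scale scale \<sigma>"
    and mult: "\<sigma> (p * q) = \<sigma> q * \<sigma> p" and inv: "\<sigma> (\<sigma> q) = q"
    and comm: "q * \<sigma> q = \<sigma> q * q" and nrm: "q * \<sigma> q \<in> Z" for p q
    using assms unfolding is_quaternion_conjugation_def Z_def by blast+
  interpret lin: Vector_Spaces.linear scale scale \<sigma> by (fact lin)
  have "\<sigma> 1 \<noteq> 0" using inv[of 1] lin.zero by auto
  moreover have "\<sigma> 1 * \<sigma> 1 = \<sigma> 1" using mult[of 1 1] by simp
  ultimately have one: "\<sigma> 1 = 1" by simp
  have onZ: "\<sigma> z = z" if "z \<in> Z" for z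
    using that lin.scale one by (auto simp: Z_def)
  show "\<sigma> q = cj q"
  proof (cases "q \<in> Z")
    case True
    then show ?thesis by (simp add: onZ cj_on_Z)
  next
    case False
    \<comment> \<open>The norm of \<open>1 + q\<close> is
      \<open>1 + (q + \<sigma> q) + q * \<sigma> q\<close>, so centrality of norms yields centrality
      of the trace.\<close>
    have "(1 + q) * \<sigma> (1 + q) - 1 - q * \<sigma> q \<in> Z"
      using nrm Z_1 Z_diff by blast
    then have s: "q + \<sigma> q \<in> Z"
      by (simp add: lin.add one algebra_simps)
    have "q * q - (q + \<sigma> q) * q = - (q * \<sigma> q)"
      by (simp add: algebra_simps comm)
    with s have "tq q = q + \<sigma> q"
      using False nrm[of q] by (intro tq_eqI) (auto simp: Z_minus)
    then show ?thesis by (simp add: cj_def)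
  qed
qed

lemma qconj_eq: "qconj scale = cj"
  unfolding qconj_def
  using is_quaternion_conjugation_cj is_quaternion_conjugation_unique by (rule the_equality)

section \<open>Properties of the trace, and elements of trace zero\<close>

lemma reduced_trace_eq: "reduced_trace scale q = tq q"
  by (simp add: reduced_trace_def qconj_eq cj_def)

lemma tq_sum: "tq (sum f A) = (\<Sum>i\<in>A. tq (f i))"
  by (induction A rule: infinite_finite_induct) (simp_all add: tq_add tq_on_Z Z_0)

text \<open>\<open>q * (p * q) = (q * p) * q\<close>, and the conjugates obey the same relation
  since the norm of \<open>q\<close> is central; so the two traces agree after multiplication by
  \<open>q\<close>.\<close>

lemma tq_mult_commute: "tq (p * q) = tq (q * p)"
proof (cases "q = 0")
  case False
  have t: "tq x = x + cj x" for x by (simp add: cj_def)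
  have "q * (cj q * cj p) = cj p * (q * cj q)"
    using Z_commute[OF norm_Z[of q], of "cj p"] by (simp add: mult.assoc)
  then have "q * (cj q * cj p) = cj p * (cj q * q)"
    by (simp add: cj_commute)
  then have "q * tq (p * q) = tq (q * p) * q"
    by (simp add: t cj_mult distrib_left distrib_right mult.assoc)
  also have "\<dots> = q * tq (q * p)" by (simp add: Z_commute tq_Z)
  finally show ?thesis using False by simp
qed simp

lemma Z_neq_UNIV: "\<exists>a. a \<notin> Z"
proof (rule ccontr)
  assume "\<not> ?thesis"
  then have "span {1} = UNIV" by (auto simp: span_one)
  moreover have "independent {1}"
    by (intro independent_insertI independent_empty) auto
  ultimately have "dim UNIV = card {1::'q}" by (metis dim_eq_card span_UNIV)
  then show False by (simp add: dim_4)
qed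

text \<open>The element \<open>1\<close> fails in characteristic 2. If the trace vanished
  identically, \<open>cj\<close> would be negation; as it fixes \<open>1\<close>, the characteristic
  would be 2 and \<open>cj\<close> the identity, which reverses products only if the algebra is
  commutative.\<close>

lemma tq_nonzero: "\<exists>r. tq r \<noteq> 0"
proof (rule ccontr)
  assume "\<not> ?thesis"
  then have t0: "tq r = 0" for r by simp
  then have "cj r = - r" for r by (simp add: cj_def)
  moreover have "cj 1 = 1" by (simp add: cj_on_Z Z_1)
  ultimately have one: "- 1 = (1::'q)" by metis
  have neg: "- x = x" for x :: 'q
    using arg_cong[OF one, of "\<lambda>y. y * x"] by simp
  have "p * q = q * p" for p q :: 'q
    using cj_mult[of p q] \<open>\<And>r. cj r = - r\<close> neg by simp
  then have "p \<in> Z" for p by (simp add: Z_iff)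
  then show False using Z_neq_UNIV by blast
qed

text \<open>The element \<open>p\<close> is chosen so that \<open>p\<close> and \<open>p + g\<close> have the same norm; as they also have
  the same trace, they are conjugate.\<close>

lemma trace_zero_commutator:
  assumes t: "tq g = 0" and g: "g \<noteq> 0"
  shows "\<exists>k p. k \<noteq> 0 \<and> k * (p + g) = p * k"
proof -
  obtain r where r: "tq r \<noteq> 0" using tq_nonzero ..
  define n where "n = g * cj g"
  have nZ: "n \<in> Z" by (simp add: n_def norm_Z)
  have cg: "cj g = - g" using t by (simp add: cj_def)
  then have n0: "n \<noteq> 0" using g by (simp add: n_def)
  \<comment> \<open>This factor gives \<open>tq (p * g)\<close> the value \<open>n\<close>, exactly
    what cancels the norm of \<open>g\<close> when the norm of \<open>p + g\<close> is
    expanded.\<close>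
  define z where "z = n * inverse (tq r)"
  have zZ: "z \<in> Z" using nZ tq_Z by (simp add: z_def Z_closed)
  define p where "p = z * (r * inverse g)"
  have "tq (p * g) = z * tq r"
    using g zZ by (simp add: p_def mult.assoc tq_mult_Z)
  then have tpg: "tq (p * g) = n" using r by (simp add: z_def mult.assoc)
  have pZ: "p \<notin> Z" using tpg n0 t by (auto simp: tq_mult_Z)
  have norms: "(p + g) * cj (p + g) = p * cj p"
  proof -
    have "p * g + cj (p * g) = n" using tpg by (simp add: cj_def)
    then have "p * g - g * cj p = n" by (simp add: cj_mult cg)
    then show ?thesis by (simp add: cj_add cg n_def algebra_simps)
  qed
  have traces: "tq (p + g) = tq p" by (simp add: tq_add t)
  \<comment> \<open>As \<open>p\<close> and \<open>p + g\<close> satisfy the same quadratic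
    equation, \<open>K r\<close> intertwines them for every \<open>r\<close>; all the
    \<open>K r\<close> vanish only if \<open>p\<close> is central.\<close>
  define K where "K r = p * r - r * cj (p + g)" for r
  have K: "K r * (p + g) = p * K r" for r
  proof -
    have "K r * (p + g) = p * r * (p + g) - r * ((p + g) * cj (p + g))"
      by (simp add: K_def left_diff_distrib mult.assoc cj_commute)
    moreover have "p * K r = p * (p * r) - p * r * cj (p + g)"
      by (simp add: K_def right_diff_distrib mult.assoc)
    ultimately have "K r * (p + g) - p * K r
        = p * r * tq (p + g) - r * ((p + g) * cj (p + g)) - p * p * r"
      by (simp add: cj_def algebra_simps)
    also have "\<dots> = (p * tq p - p * cj p - p * p) * r"
      unfolding traces norms
      using Z_commute[OF norm_Z, of p r] Z_commute[OF tq_Z, of p r]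
      by (simp add: algebra_simps)
    also have "\<dots> = 0" by (simp add: cj_def algebra_simps)
    finally show ?thesis by simp
  qed
  have "\<exists>r. K r \<noteq> 0"
  proof (rule ccontr)
    assume "\<not> ?thesis"
    then have 0: "p * r = r * cj (p + g)" for r by (simp add: K_def)
    from 0[of 1] have "p = cj (p + g)" by simp
    with 0 have "p * r = r * p" for r by simp
    then show False using pZ by (simp add: Z_iff)
  qed
  with K show ?thesis by blast
qed

text \<open>One nonzero commutator \<open>k = d * r - r * d\<close> satisfies the same relation as
  \<open>c\<close>, so \<open>c = k * w\<close> with \<open>w\<close> commuting with
  \<open>d\<close>, and then \<open>c\<close> is the commutator of \<open>d\<close> with
  \<open>r * w\<close>.\<close>

lemma cj_commutes_imp_commutator:
  assumes d: "d \<notin> Z" and c: "d * c = c * cj d"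
  shows "\<exists>r. c = d * r - r * d"
proof -
  obtain r where r: "d * r \<noteq> r * d" using d Z_iff by blast
  define k where "k = d * r - r * d"
  have k0: "k \<noteq> 0" using r by (simp add: k_def)
  have kd: "k * d = cj d * k" unfolding k_def by (rule commutator_cj)
  have kd': "k * cj d = d * k"
  proof -
    have "k * cj d = k * tq d - k * d" by (simp add: cj_def right_diff_distrib)
    also have "\<dots> = (tq d - cj d) * k" using kd tq_Z[of d] by (simp add: Z_commute left_diff_distrib)
    finally show ?thesis by (simp add: cj_def)
  qed
  define w where "w = inverse k * c"
  have ckw: "c = k * w" using k0 by (simp add: w_def mult.assoc[symmetric])
  have "k * (cj d * w) = d * c" using kd' by (simp add: ckw flip: mult.assoc)
  also have "\<dots> = k * (w * cj d)" using c by (simp add: ckw mult.assoc)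
  finally have "cj d * w = w * cj d" using k0 by simp
  then have "d * w = w * d"
    using tq_Z[of d] by (simp add: cj_def algebra_simps Z_ac)
  then have "c = d * (r * w) - r * w * d"
    by (simp add: ckw k_def algebra_simps)
  then show ?thesis ..
qed

end

section \<open>Bases, matrices and compressions\<close>

context right_vector_space
begin

lemma act_zero_right [simp]: "act x 0 = 0"
  using act_add_right[of x 0 0] by simp

lemma act_zero_left [simp]: "act 0 q = 0"
  using act_add_left[of 0 0 q] by simp

lemma act_minus_right: "act x (- q) = - act x q"
  using act_add_right[of x q "- q"] by (simp add: eq_neg_iff_add_eq_0 add.commute)

lemma act_minus_left: "act (- x) q = - act x q"
  using act_add_left[of x "- x" q] by (simp add: eq_neg_iff_add_eq_0 add.commute)

lemma act_diff_right: "act x (p - q) = act x p - act x q"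
  using act_add_right[of x p "- q"] by (simp add: act_minus_right)

lemma act_diff_left: "act (x - y) q = act x q - act y q"
  using act_add_left[of x "- y" q] by (simp add: act_minus_left)

lemma act_sum_left: "act (sum f A) q = (\<Sum>i\<in>A. act (f i) q)"
  by (induction A rule: infinite_finite_induct) (simp_all add: act_add_left)

lemma act_sum_right: "act x (sum f A) = (\<Sum>i\<in>A. act x (f i))"
  by (induction A rule: infinite_finite_induct) (simp_all add: act_add_right)

lemmas act_simps = act_add_left act_add_right act_diff_left act_diff_right
  act_minus_left act_minus_right act_one act_mult[symmetric]

lemma act_eq_0_iff: "act x q = 0 \<longleftrightarrow> x = 0 \<or> q = 0"
  by (metis act_mult act_one act_zero_left act_zero_right right_inverse)

section \<open>Linear combinations and subspaces\<close>

definition lc :: "nat \<Rightarrow> (nat \<Rightarrow> 'v) \<Rightarrow> (nat \<Rightarrow> 'q) \<Rightarrow> 'v" where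
  "lc n e c = (\<Sum>i<n. act (e i) (c i))"

definition subsp :: "'v set \<Rightarrow> bool" where
  "subsp W \<longleftrightarrow> 0 \<in> W \<and> (\<forall>x\<in>W. \<forall>y\<in>W. x + y \<in> W) \<and> (\<forall>x\<in>W. \<forall>q. act x q \<in> W)"

lemma subsp_0: "subsp W \<Longrightarrow> 0 \<in> W"
  and subsp_add: "subsp W \<Longrightarrow> x \<in> W \<Longrightarrow> y \<in> W \<Longrightarrow> x + y \<in> W"
  and subsp_act: "subsp W \<Longrightarrow> x \<in> W \<Longrightarrow> act x q \<in> W"
  by (auto simp: subsp_def)

lemma subsp_minus: "subsp W \<Longrightarrow> x \<in> W \<Longrightarrow> - x \<in> W"
  using subsp_act[of W x "- 1"] by (simp add: act_minus_right act_one)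

lemma subsp_diff: "subsp W \<Longrightarrow> x \<in> W \<Longrightarrow> y \<in> W \<Longrightarrow> x - y \<in> W"
  using subsp_add[of W x "- y"] subsp_minus by simp

lemma subsp_sum: "subsp W \<Longrightarrow> (\<And>i. i \<in> A \<Longrightarrow> f i \<in> W) \<Longrightarrow> sum f A \<in> W"
  by (induction A rule: infinite_finite_induct) (auto simp: subsp_0 subsp_add)

lemma subsp_lc: "subsp W \<Longrightarrow> (\<And>i. i < n \<Longrightarrow> e i \<in> W) \<Longrightarrow> lc n e c \<in> W"
  unfolding lc_def by (intro subsp_sum subsp_act) auto

lemma subsp_UNIV: "subsp UNIV"
  by (simp add: subsp_def)

lemma lc_cong: "(\<And>i. i < n \<Longrightarrow> e i = f i) \<Longrightarrow> (\<And>i. i < n \<Longrightarrow> c i = d i) \<Longrightarrow> lc n e c = lc n f d"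
  unfolding lc_def by (intro sum.cong) auto

lemma lc_add: "lc n e c + lc n e d = lc n e (\<lambda>i. c i + d i)"
  by (simp add: lc_def act_add_right sum.distrib)

lemma lc_diff: "lc n e c - lc n e d = lc n e (\<lambda>i. c i - d i)"
  by (simp add: lc_def act_diff_right sum_subtractf)

lemma lc_act: "act (lc n e c) q = lc n e (\<lambda>i. c i * q)"
  by (simp add: lc_def act_sum_left act_mult)

lemma lc_zero: "lc n e (\<lambda>i. 0) = 0"
  by (simp add: lc_def)

lemma lc_lc: "lc n (\<lambda>l. lc m f (\<lambda>i. A i l)) c = lc m f (\<lambda>i. \<Sum>l<n. A i l * c l)"
  unfolding lc_def act_sum_left act_sum_right act_mult
  by (rule sum.swap)

lemma lc_single: "k < n \<Longrightarrow> lc n e (\<lambda>i. if i = k then q else 0) = act (e k) q"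
  unfolding lc_def by (subst sum.cong[OF refl, of _ _ "\<lambda>i. if i = k then act (e k) q else 0"]) auto

lemma lc_Suc_shift: "lc (Suc n) e c = act (e 0) (c 0) + lc n (e \<circ> Suc) (c \<circ> Suc)"
  unfolding lc_def by (subst sum.lessThan_Suc_shift) simp

lemma mem_family_span: "v \<in> family_span act n e \<longleftrightarrow> (\<exists>c. v = lc n e c)"
  by (auto simp: family_span_def lc_def)

lemma subsp_family_span: "subsp (family_span act n e)"
  unfolding subsp_def mem_family_span
proof (intro conjI ballI allI)
  show "\<exists>c. 0 = lc n e c" using lc_zero[of n e] by (metis (no_types))
qed (auto simp: mem_family_span lc_add lc_act)

section \<open>Bases and the exchange argument\<close>

lemma family_independent_iff:
  "family_independent act n e \<longleftrightarrow> (\<forall>c. lc n e c = 0 \<longrightarrow> (\<forall>i<n. c i = 0))"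
  by (simp add: family_independent_def lc_def)

lemma is_basisD:
  assumes "is_basis act W n e"
  shows "subsp W" and "\<And>i. i < n \<Longrightarrow> e i \<in> W"
    and "\<And>v. v \<in> W \<longleftrightarrow> (\<exists>c. v = lc n e c)"
    and "\<And>c. lc n e c = 0 \<Longrightarrow> i < n \<Longrightarrow> c i = 0"
proof -
  have W: "W = family_span act n e" using assms by (simp add: is_basis_def)
  show "subsp W" by (simp add: W subsp_family_span)
  show "e i \<in> W" if "i < n" for i
    using lc_single[OF that, of e 1] by (auto simp: W mem_family_span act_one) (metis)
  show "\<And>v. v \<in> W \<longleftrightarrow> (\<exists>c. v = lc n e c)" by (simp add: W mem_family_span)
  show "\<And>c. lc n e c = 0 \<Longrightarrow> i < n \<Longrightarrow> c i = 0"
    using assms by (simp add: is_basis_def family_independent_iff)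
qed

lemma basis_coordsE:
  assumes "is_basis act W n e" "v \<in> W"
  obtains c where "v = lc n e c"
  using is_basisD(3)[OF assms(1), THEN iffD1, OF assms(2)] by (rule exE)

lemma is_basisI:
  assumes "subsp W" "\<And>i. i < n \<Longrightarrow> e i \<in> W" "\<And>v. v \<in> W \<Longrightarrow> \<exists>c. v = lc n e c"
    and "\<And>c i. lc n e c = 0 \<Longrightarrow> i < n \<Longrightarrow> c i = 0"
  shows "is_basis act W n e"
  using assms subsp_lc[of W n e]
  by (auto simp: is_basis_def family_independent_iff mem_family_span set_eq_iff)

lemma lc_unique:
  assumes "is_basis act W n e" "lc n e c = lc n e d" "i < n"
  shows "c i = d i"
  using is_basisD(4)[OF assms(1), of "\<lambda>i. c i - d i" i] assms(2,3) by (simp add: lc_diff[symmetric])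

lemma is_basis_cong:
  assumes "is_basis act W n e" "\<And>i. i < n \<Longrightarrow> e i = f i"
  shows "is_basis act W n f"
proof -
  have "lc n f c = lc n e c" for c using assms(2) by (intro lc_cong) auto
  with assms(1) show ?thesis
    by (auto simp: is_basis_def family_independent_iff mem_family_span set_eq_iff)
qed

lemma is_basis_exchange:
  assumes b: "is_basis act W n e" and k: "k < n" and ck: "c k \<noteq> 0"
  shows "is_basis act W n (e(k := lc n e c))"
proof -
  let ?f = "e(k := lc n e c)"
  have eq: "lc n ?f d = lc n e (\<lambda>i. (if i = k then 0 else d i) + c i * d k)" for d
  proof -
    have "lc n ?f d = lc n ?f (\<lambda>i. (if i = k then d k else 0) + (if i = k then 0 else d i))"
      by (intro lc_cong) auto
    also have "\<dots> = act (lc n e c) (d k) + lc n e (\<lambda>i. if i = k then 0 else d i)"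
    proof -
      have "lc n ?f (\<lambda>i. if i = k then d k else 0) = act (lc n e c) (d k)"
        using lc_single[OF k, of ?f] by simp
      moreover have "lc n ?f (\<lambda>i. if i = k then 0 else d i) = lc n e (\<lambda>i. if i = k then 0 else d i)"
        unfolding lc_def by (intro sum.cong) auto
      ultimately show ?thesis by (simp only: lc_add[symmetric])
    qed
    finally show ?thesis by (simp add: lc_act lc_add add.commute)
  qed
  show ?thesis
  proof (rule is_basisI)
    show "subsp W" using b by (rule is_basisD)
    show "?f i \<in> W" if "i < n" for i
      using that is_basisD(2,3)[OF b] by auto
    show "\<exists>d. v = lc n ?f d" if "v \<in> W" for v
    proof -
      obtain a where a: "v = lc n e a" by (rule basis_coordsE[OF b \<open>v \<in> W\<close>])
      \<comment> \<open>The new vector alone contributes along \<open>e k\<close>, which fixes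
        \<open>d k\<close>; its contributions along the other \<open>e i\<close> are then
        subtracted.\<close>
      define d where "d i = (if i = k then inverse (c k) * a k else a i - c i * (inverse (c k) * a k))" for i
      have "v = lc n ?f d"
        unfolding eq a using ck by (intro lc_cong) (auto simp: d_def mult.assoc[symmetric])
      then show ?thesis by blast
    qed
    show "d i = 0" if "lc n ?f d = 0" "i < n" for d i
    proof -
      have 0: "(if i = k then 0 else d i) + c i * d k = 0" if "i < n" for i
        using is_basisD(4)[OF b] \<open>lc n ?f d = 0\<close> that unfolding eq by blast
      have "d k = 0" using 0[OF k] ck by simp
      then show ?thesis using 0[OF \<open>i < n\<close>] by (auto split: if_splits)
    qed
  qed
qed

lemma is_basis_permute:
  assumes b: "is_basis act W n e" and p: "bij_betw p {..<n} {..<n}"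
  shows "is_basis act W n (e \<circ> p)"
proof -
  have eq: "lc n (e \<circ> p) (c \<circ> p) = lc n e c" for c
    using sum.reindex_bij_betw[OF p, of "\<lambda>i. act (e i) (c i)"] by (simp add: lc_def)
  have pl: "p i < n" if "i < n" for i using p that by (auto simp: bij_betw_def)
  show ?thesis
  proof (rule is_basisI)
    show "subsp W" using b by (rule is_basisD)
    show "(e \<circ> p) i \<in> W" if "i < n" for i
      using is_basisD(2)[OF b pl[OF that]] by simp
    show "\<exists>d. v = lc n (e \<circ> p) d" if "v \<in> W" for v
      using that eq is_basisD(3)[OF b] by metis
    show "d i = 0" if 0: "lc n (e \<circ> p) d = 0" and i: "i < n" for d i
    proof -
      define c where "c = d \<circ> inv_into {..<n} p"
      have cp: "(c \<circ> p) i = d i" if "i < n" for i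
        using bij_betw_inv_into_left[OF p, of i] that by (simp add: c_def)
      then have "lc n (e \<circ> p) (c \<circ> p) = 0" using 0 by (metis (no_types, lifting) lc_cong)
      then have "c (p i) = 0" using is_basisD(4)[OF b] pl[OF i] eq by metis
      then show ?thesis using cp[OF i] by simp
    qed
  qed
qed

lemma family_independent_mono:
  assumes "family_independent act n f" "k \<le> n"
  shows "family_independent act k f"
  unfolding family_independent_iff
proof (intro allI impI)
  fix c i assume c: "lc k f c = 0" and i: "i < k"
  have "lc n f (\<lambda>i. if i < k then c i else 0) = (\<Sum>i<k. act (f i) (if i < k then c i else 0))"
    unfolding lc_def using assms(2) by (intro sum.mono_neutral_right) auto
  also have "\<dots> = lc k f c" unfolding lc_def by (intro sum.cong) auto
  finally have "lc n f (\<lambda>i. if i < k then c i else 0) = 0" using c by simp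
  moreover have "i < n" using i assms(2) by simp
  ultimately have "(if i < k then c i else 0) = 0"
    using assms(1) unfolding family_independent_iff by blast
  then show "c i = 0" using i by simp
qed

text \<open>Steinitz exchange, one vector at a time. The bound \<open>k \<le> n\<close> comes along
  because each exchange uses up a fresh index of the basis.\<close>

lemma basis_extend:
  assumes "is_basis act W n e" "family_independent act k f" "\<And>i. i < k \<Longrightarrow> f i \<in> W"
  shows "k \<le> n \<and> (\<exists>e'. is_basis act W n e' \<and> (\<forall>i<k. e' i = f i))"
  using assms(2,3)
proof (induction k)
  case 0
  then show ?case using assms(1) by auto
next
  case (Suc k)
  have ik: "family_independent act k f"
    using Suc.prems(1) by (rule family_independent_mono) simp
  then obtain g where "k \<le> n" and g: "is_basis act W n g" and gf: "\<forall>i<k. g i = f i"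
    using Suc by auto
  obtain c where c: "f k = lc n g c"
    using Suc.prems(2)[of k] is_basisD(3)[OF g] by auto
  \<comment> \<open>Otherwise \<open>f k\<close> would be a combination of the earlier
    \<open>f i\<close>; the coefficient \<open>- 1\<close> turns this into a dependence.\<close>
  have "\<exists>j. k \<le> j \<and> j < n \<and> c j \<noteq> 0"
  proof (rule ccontr)
    assume "\<not> ?thesis"
    then have c0: "c j = 0" if "k \<le> j" "j < n" for j using that by blast
    have "lc n g c = (\<Sum>i<k. act (g i) (c i))"
      unfolding lc_def using \<open>k \<le> n\<close> c0 by (intro sum.mono_neutral_right) auto
    then have "f k = (\<Sum>i<k. act (f i) (c i))" using c gf by simp
    then have "lc (Suc k) f (\<lambda>i. if i = k then - 1 else c i) = 0"
      by (simp add: lc_def act_minus_right act_one)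
    then have "(if k = k then - 1 else c k) = 0"
      using Suc.prems(1) unfolding family_independent_iff by blast
    then show False by simp
  qed
  then obtain j where j: "k \<le> j" "j < n" "c j \<noteq> 0" by blast
  \<comment> \<open>The exchange puts \<open>f k\<close> at index \<open>j\<close>; this
    transposition moves it to index \<open>k\<close> and leaves the earlier vectors in
    place.\<close>
  define p where "p i = (if i = j then k else if i = k then j else i)" for i
  have "bij_betw p {..<n} {..<n}"
    by (rule bij_betw_byWitness[where f' = p]) (use j in \<open>auto simp: p_def\<close>)
  then have b: "is_basis act W n (g(j := f k) \<circ> p)"
    unfolding c using is_basis_exchange[where c = c, OF g j(2,3)] by (intro is_basis_permute)
  have "(g(j := f k) \<circ> p) i = f i" if "i < Suc k" for i
    using that j gf by (auto simp: p_def less_Suc_eq)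
  with b j show ?case by auto
qed

lemma independent_imp_basis:
  assumes "is_basis act W n e" "family_independent act n f" "\<And>i. i < n \<Longrightarrow> f i \<in> W"
  shows "is_basis act W n f"
  using basis_extend[OF assms] is_basis_cong by metis

lemma family_independent_2:
  "family_independent act 2 f \<longleftrightarrow>
     (\<forall>a b. act (f 0) a + act (f 1) b = 0 \<longrightarrow> a = 0 \<and> b = 0)" (is "?l \<longleftrightarrow> ?r")
proof
  assume ?l
  then show ?r
    unfolding family_independent_def
    by (intro allI impI, drule_tac x = "\<lambda>i. if i = 0 then a else b" in spec)
       (simp add: eval_nat_numeral All_less_Suc)
qed (simp add: family_independent_def eval_nat_numeral All_less_Suc)

lemma family_independent_3:
  "family_independent act 3 f \<longleftrightarrow>
     (\<forall>a b c. act (f 0) a + act (f 1) b + act (f 2) c = 0 \<longrightarrow> a = 0 \<and> b = 0 \<and> c = 0)"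
  (is "?l \<longleftrightarrow> ?r")
proof
  assume ?l
  then show ?r
    unfolding family_independent_def
    by (intro allI impI, drule_tac x = "\<lambda>i. if i = 0 then a else if i = 1 then b else c" in spec)
       (simp add: eval_nat_numeral All_less_Suc)
next
  assume ?r
  then show ?l
    by (fastforce simp add: family_independent_def eval_nat_numeral All_less_Suc)
qed

lemma family_independent_4:
  "family_independent act 4 f \<longleftrightarrow>
     (\<forall>a b c d. act (f 0) a + act (f 1) b + act (f 2) c + act (f 3) d = 0
        \<longrightarrow> a = 0 \<and> b = 0 \<and> c = 0 \<and> d = 0)"
  (is "?l \<longleftrightarrow> ?r")
proof
  assume ?l
  then show ?r
    unfolding family_independent_def
    by (intro allI impI,
        drule_tac x = "\<lambda>i. if i = 0 then a else if i = 1 then b else if i = 2 then c else d" in spec)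
       (simp add: eval_nat_numeral All_less_Suc)
next
  assume ?r
  then show ?l
    by (fastforce simp add: family_independent_def eval_nat_numeral All_less_Suc)
qed

section \<open>Linear maps on subspaces and their matrices\<close>

definition lin_on :: "'v set \<Rightarrow> ('v \<Rightarrow> 'v) \<Rightarrow> bool" where
  "lin_on W u \<longleftrightarrow> (\<forall>x\<in>W. \<forall>y\<in>W. u (x + y) = u x + u y) \<and>
     (\<forall>x\<in>W. \<forall>q. u (act x q) = act (u x) q) \<and> (\<forall>x\<in>W. u x \<in> W)"

lemma lin_on_UNIV: "lin_on UNIV u \<longleftrightarrow> endomorphism act u"
  by (simp add: lin_on_def endomorphism_def)

lemma lin_on_add: "lin_on W u \<Longrightarrow> x \<in> W \<Longrightarrow> y \<in> W \<Longrightarrow> u (x + y) = u x + u y"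
  and lin_on_act: "lin_on W u \<Longrightarrow> x \<in> W \<Longrightarrow> u (act x q) = act (u x) q"
  and lin_on_mem: "lin_on W u \<Longrightarrow> x \<in> W \<Longrightarrow> u x \<in> W"
  by (auto simp: lin_on_def)

lemma lin_on_zero: "lin_on W u \<Longrightarrow> subsp W \<Longrightarrow> u 0 = 0"
  using lin_on_act[of W u 0 0] subsp_0 by auto

lemma lin_on_lc:
  assumes u: "lin_on W u" and W: "subsp W" and e: "\<And>i. i < n \<Longrightarrow> e i \<in> W"
  shows "u (lc n e c) = lc n (u \<circ> e) c"
  using e
proof (induction n)
  case 0
  show ?case using lin_on_zero[OF u W] by (simp add: lc_def)
next
  case (Suc n)
  have "lc (Suc n) e c = lc n e c + act (e n) (c n)" by (simp add: lc_def)
  moreover have "lc n e c \<in> W" "e n \<in> W" using Suc.prems subsp_lc[OF W] by auto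
  ultimately have "u (lc (Suc n) e c) = lc n (u \<circ> e) c + act (u (e n)) (c n)"
    using Suc u W by (simp add: lin_on_add lin_on_act subsp_act comp_def)
  then show ?case by (simp add: lc_def comp_def)
qed

text \<open>The inductions on the dimension pass to subspaces of one fixed type, so
  \<open>represented_by\<close> is made relative to a carrier \<open>W\<close>; values of
  \<open>u\<close> outside \<open>W\<close> do not matter.\<close>

definition rep :: "'v set \<Rightarrow> ('v \<Rightarrow> 'v) \<Rightarrow> nat \<Rightarrow> (nat \<Rightarrow> 'v) \<Rightarrow> (nat \<Rightarrow> nat \<Rightarrow> 'q) \<Rightarrow> bool" where
  "rep W u n e M \<longleftrightarrow> is_basis act W n e \<and> (\<forall>j<n. u (e j) = lc n e (\<lambda>i. M i j))"

lemma rep_UNIV: "rep UNIV u n e M \<longleftrightarrow> represented_by act u n e M"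
  by (simp add: rep_def represented_by_def lc_def)

lemma rep_exists:
  assumes "is_basis act W n e" "lin_on W u"
  shows "\<exists>M. rep W u n e M"
proof -
  have "\<forall>j. \<exists>c. j < n \<longrightarrow> u (e j) = lc n e c"
    using is_basisD(2,3)[OF assms(1)] lin_on_mem[OF assms(2)] by metis
  then obtain C where "\<forall>j. j < n \<longrightarrow> u (e j) = lc n e (C j)" by metis
  then have "rep W u n e (\<lambda>i j. C j i)" using assms(1) by (simp add: rep_def)
  then show ?thesis by blast
qed

lemma map_of_matrix:
  assumes b: "is_basis act W n e"
  shows "\<exists>u. lin_on W u \<and> rep W u n e M"
proof -
  define crd where "crd v = (SOME c. v = lc n e c)" for v
  have crd: "v = lc n e (crd v)" if "v \<in> W" for v
    unfolding crd_def
    using is_basisD(3)[OF b, THEN iffD1, OF that] by (rule someI_ex[where P = "\<lambda>c. v = lc n e c"])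
  have crdI: "crd v i = c i" if "v = lc n e c" "i < n" for v c i
    using lc_unique[OF b, of "crd v" c i] crd[of v] that is_basisD(3)[OF b] by metis
  define u where "u v = lc n e (\<lambda>i. \<Sum>j<n. M i j * crd v j)" for v
  have uI: "u v = lc n e (\<lambda>i. \<Sum>j<n. M i j * c j)" if "v = lc n e c" for v c
    unfolding u_def using crdI[OF that] by (intro lc_cong) auto
  have "lin_on W u"
    unfolding lin_on_def
  proof (intro conjI ballI allI)
    fix x y q assume x: "x \<in> W" and y: "y \<in> W"
    have "x + y = lc n e (\<lambda>i. crd x i + crd y i)"
      unfolding lc_add[symmetric] using crd[OF x] crd[OF y] by simp
    from uI[OF this] show "u (x + y) = u x + u y"
      unfolding u_def[of x] u_def[of y] by (simp add: lc_add distrib_left sum.distrib)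
  next
    fix x q assume x: "x \<in> W"
    have "act x q = lc n e (\<lambda>i. crd x i * q)"
      unfolding lc_act[symmetric] using crd[OF x] by simp
    from uI[OF this] show "u (act x q) = act (u x) q"
      unfolding u_def[of x] by (simp add: lc_act sum_distrib_right mult.assoc)
    show "u x \<in> W" using is_basisD(3)[OF b] by (auto simp: u_def)
  qed
  moreover have "rep W u n e M"
    unfolding rep_def
  proof (intro conjI allI impI b)
    fix j assume j: "j < n"
    have "u (e j) = lc n e (\<lambda>i. \<Sum>k<n. M i k * (if k = j then 1 else 0))"
      using lc_single[OF j, of e 1] by (intro uI) (simp add: act_one)
    then show "u (e j) = lc n e (\<lambda>i. M i j)"
      using j by (simp add: if_distrib cong: if_cong)
  qed
  ultimately show ?thesis by blast
qed

section \<open>Splitting off the first basis vector\<close>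

lemma is_basis_tail:
  assumes b: "is_basis act W (Suc m) e"
  shows "is_basis act (family_span act m (e \<circ> Suc)) m (e \<circ> Suc)"
  unfolding is_basis_def
proof
  show "family_independent act m (e \<circ> Suc)"
    unfolding family_independent_iff
  proof (intro allI impI)
    fix c i assume c: "lc m (e \<circ> Suc) c = 0" and i: "i < m"
    have "lc (Suc m) e (case_nat 0 c) = 0"
      using c by (simp add: lc_Suc_shift comp_def)
    then have "case_nat 0 c (Suc i) = 0"
      using is_basisD(4)[OF b] i by blast
    then show "c i = 0" by simp
  qed
qed simp

lemma tail_subset:
  assumes b: "is_basis act W (Suc m) e"
  shows "family_span act m (e \<circ> Suc) \<subseteq> W"
  using subsp_lc[OF is_basisD(1)[OF b], of m "e \<circ> Suc"] is_basisD(2)[OF b]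
  by (auto simp: mem_family_span)

lemma head_tail_unique:
  assumes b: "is_basis act W (Suc m) e" and w: "w \<in> family_span act m (e \<circ> Suc)"
    and 0: "act (e 0) c + w = 0"
  shows "c = 0 \<and> w = 0"
proof -
  obtain d where d: "w = lc m (e \<circ> Suc) d" using w by (auto simp: mem_family_span)
  have "lc (Suc m) e (case_nat c d) = 0"
    using 0 d by (simp add: lc_Suc_shift comp_def)
  then have "case_nat c d 0 = 0"
    using is_basisD(4)[OF b] by blast
  then show ?thesis using 0 by simp
qed

lemma is_basis_new_tail:
  assumes b: "is_basis act W (Suc m) e"
    and f: "is_basis act (family_span act m (e \<circ> Suc)) m f"
  shows "is_basis act W (Suc m) (case_nat (e 0) f)"
proof -
  let ?W = "family_span act m (e \<circ> Suc)"
  have eq: "lc (Suc m) (case_nat (e 0) f) c = act (e 0) (c 0) + lc m f (c \<circ> Suc)" for c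
    by (simp add: lc_Suc_shift comp_def)
  show ?thesis
  proof (rule is_basisI)
    show "subsp W" using b by (rule is_basisD)
    show "case_nat (e 0) f i \<in> W" if "i < Suc m" for i
      using that is_basisD(2)[OF b] is_basisD(2)[OF f] tail_subset[OF b] by (cases i) auto
    show "\<exists>c. v = lc (Suc m) (case_nat (e 0) f) c" if "v \<in> W" for v
    proof -
      obtain a where a: "v = lc (Suc m) e a" by (rule basis_coordsE[OF b \<open>v \<in> W\<close>])
      obtain d where d: "lc m (e \<circ> Suc) (a \<circ> Suc) = lc m f d"
        using is_basisD(3)[OF f] mem_family_span by blast
      have "v = lc (Suc m) (case_nat (e 0) f) (case_nat (a 0) d)"
        using a d by (simp add: lc_Suc_shift comp_def)
      then show ?thesis by blast
    qed
    show "c i = 0" if 0: "lc (Suc m) (case_nat (e 0) f) c = 0" and i: "i < Suc m" for c i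
    proof -
      have "lc m f (c \<circ> Suc) \<in> ?W" using is_basisD(3)[OF f] by blast
      with 0 have "c 0 = 0 \<and> lc m f (c \<circ> Suc) = 0"
        using head_tail_unique[OF b] by (simp add: eq)
      then show ?thesis
        using i is_basisD(4)[OF f, of "c \<circ> Suc"] by (cases i) auto
    qed
  qed
qed

text \<open>Deleting the first row and column of \<open>M\<close> gives the matrix of
  \<open>u\<close> followed by the projection onto \<open>W'\<close> along \<open>e 0\<close>; this
  is \<open>u'\<close>.\<close>

lemma compression:
  assumes r: "rep W u (Suc m) e M" and u: "lin_on W u"
  defines "W' \<equiv> family_span act m (e \<circ> Suc)"
  shows "\<exists>u'. lin_on W' u' \<and> rep W' u' m (e \<circ> Suc) (\<lambda>i j. M (Suc i) (Suc j)) \<and>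
           (\<forall>w\<in>W'. \<exists>c. u w = act (e 0) c + u' w)"
proof -
  have b: "is_basis act W (Suc m) e" and col: "\<And>j. j < Suc m \<Longrightarrow> u (e j) = lc (Suc m) e (\<lambda>i. M i j)"
    using r by (auto simp: rep_def)
  have b': "is_basis act W' m (e \<circ> Suc)" unfolding W'_def using b by (rule is_basis_tail)
  obtain u' where u': "lin_on W' u'" "rep W' u' m (e \<circ> Suc) (\<lambda>i j. M (Suc i) (Suc j))"
    using map_of_matrix[OF b', of "\<lambda>i j. M (Suc i) (Suc j)"] by blast
  have ue: "u (e (Suc j)) = act (e 0) (M 0 (Suc j)) + u' (e (Suc j))" if "j < m" for j
    using that col[of "Suc j"] u'(2) by (simp add: rep_def lc_Suc_shift comp_def)
  have "\<exists>c. u w = act (e 0) c + u' w" if "w \<in> W'" for w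
  proof -
    obtain c where c: "w = lc m (e \<circ> Suc) c" using \<open>w \<in> W'\<close> unfolding W'_def mem_family_span by auto
    have "u w = lc m (u \<circ> (e \<circ> Suc)) c"
      unfolding c using is_basisD(1,2)[OF b] by (intro lin_on_lc[OF u]) auto
    also have "\<dots> = (\<Sum>j<m. act (e 0) (M 0 (Suc j) * c j)) + lc m (u' \<circ> (e \<circ> Suc)) c"
      unfolding lc_def sum.distrib[symmetric]
      by (intro sum.cong) (auto simp: ue act_add_left act_mult)
    also have "lc m (u' \<circ> (e \<circ> Suc)) c = u' w"
      unfolding c using is_basisD(1,2)[OF b'] by (intro lin_on_lc[OF u'(1), symmetric]) auto
    finally show ?thesis by (auto simp: act_sum_right[symmetric])
  qed
  with u' show ?thesis by blast
qed

section \<open>Zero diagonals and sums of nilpotent maps\<close>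

definition zero_diagonal :: "'v set \<Rightarrow> ('v \<Rightarrow> 'v) \<Rightarrow> nat \<Rightarrow> (nat \<Rightarrow> 'v) \<Rightarrow> bool" where
  "zero_diagonal W u n e \<longleftrightarrow> is_basis act W n e \<and> (\<forall>j<n. \<exists>c. c j = 0 \<and> u (e j) = lc n e c)"

text \<open>On the tail, \<open>u\<close> and \<open>u'\<close> differ by multiples of
  \<open>e 0\<close>, which do not touch the remaining diagonal entries; the first one vanishes by
  \<open>head\<close>, whatever basis of the tail is chosen.\<close>

lemma zero_diagonal_lift:
  assumes b: "is_basis act W (Suc m) e"
    and head: "u (e 0) \<in> family_span act m (e \<circ> Suc)"
    and z: "zero_diagonal (family_span act m (e \<circ> Suc)) u' m f"
    and u': "\<And>w. w \<in> family_span act m (e \<circ> Suc) \<Longrightarrow> \<exists>c. u w = act (e 0) c + u' w"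
  shows "zero_diagonal W u (Suc m) (case_nat (e 0) f)"
proof -
  let ?g = "case_nat (e 0) f"
  have f: "is_basis act (family_span act m (e \<circ> Suc)) m f" using z by (simp add: zero_diagonal_def)
  have "\<exists>c. c j = 0 \<and> u (?g j) = lc (Suc m) ?g c" if "j < Suc m" for j
  proof (cases j)
    case 0
    obtain d where "u (e 0) = lc m f d" using head is_basisD(3)[OF f] by blast
    then show ?thesis
      using 0 by (intro exI[of _ "case_nat 0 d"]) (simp add: lc_Suc_shift comp_def)
  next
    case (Suc k)
    then have k: "k < m" using that by simp
    obtain c where c: "u (f k) = act (e 0) c + u' (f k)" using u' is_basisD(2)[OF f k] by blast
    obtain d where "d k = 0" "u' (f k) = lc m f d" using z k by (auto simp: zero_diagonal_def)
    then show ?thesis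
      using c Suc by (intro exI[of _ "case_nat c d"]) (simp add: lc_Suc_shift comp_def)
  qed
  then show ?thesis
    using is_basis_new_tail[OF b f] by (simp add: zero_diagonal_def)
qed

lemma zero_diagonal_rep:
  assumes "zero_diagonal W u n e"
  shows "\<exists>M. rep W u n e M \<and> (\<forall>i<n. M i i = 0)"
proof -
  have "\<forall>j. \<exists>c. j < n \<longrightarrow> c j = 0 \<and> u (e j) = lc n e c"
    using assms by (auto simp: zero_diagonal_def)
  then obtain C where "\<forall>j. j < n \<longrightarrow> C j j = 0 \<and> u (e j) = lc n e (C j)" by metis
  then have "rep W u n e (\<lambda>i j. C j i) \<and> (\<forall>i<n. C i i = 0)"
    using assms by (simp add: rep_def zero_diagonal_def)
  then show ?thesis by blast
qed

text \<open>Each application of \<open>a\<close> lowers the height \<open>h\<close>, so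
  \<open>k\<close> applications kill every basis vector. A general height treats upper and lower
  triangular matrices at once.\<close>

lemma graded_nilpotent:
  fixes h :: "nat \<Rightarrow> nat"
  assumes r: "rep UNIV a n e M" and a: "endomorphism act a"
    and h: "\<And>i j. i < n \<Longrightarrow> j < n \<Longrightarrow> M i j \<noteq> 0 \<Longrightarrow> h i < h j"
    and bound: "\<And>j. j < n \<Longrightarrow> h j < k"
  shows "nilpotent a"
proof -
  have b: "is_basis act UNIV n e" using r by (simp add: rep_def)
  have lin: "lin_on UNIV (a ^^ k)" for k
    using a unfolding lin_on_UNIV by (induction k) (simp_all add: endomorphism_def)
  have pow: "(a ^^ k) (e j) = 0" if "j < n" "h j < k" for j k
    using that
  proof (induction k arbitrary: j)
    case (Suc k)
    have "(a ^^ Suc k) (e j) = (a ^^ k) (lc n e (\<lambda>i. M i j))"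
      using r Suc.prems by (simp add: rep_def funpow_swap1)
    also have "\<dots> = lc n ((a ^^ k) \<circ> e) (\<lambda>i. M i j)"
      by (rule lin_on_lc[OF lin subsp_UNIV]) simp
    also have "\<dots> = 0"
      unfolding lc_def
    proof (intro sum.neutral ballI)
      fix i assume i: "i \<in> {..<n}"
      show "act (((a ^^ k) \<circ> e) i) (M i j) = 0"
      proof (cases "M i j = 0")
        case False
        then have "h i < k" using h[of i j] i Suc.prems by auto
        then show ?thesis using Suc.IH i by simp
      qed simp
    qed
    finally show ?case .
  qed simp
  have "(a ^^ k) v = 0" for v
  proof -
    obtain c where "v = lc n e c" using is_basisD(3)[OF b] by auto
    then have "(a ^^ k) v = lc n ((a ^^ k) \<circ> e) c"
      using lin_on_lc[OF lin subsp_UNIV, of n e k c] by simp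
    then show ?thesis using pow bound by (simp add: lc_def)
  qed
  then show ?thesis by (auto simp: nilpotent_def)
qed

lemma endomorphism_eqI:
  assumes b: "is_basis act UNIV n e" and "endomorphism act u" "endomorphism act v"
    and eq: "\<And>j. j < n \<Longrightarrow> u (e j) = v (e j)"
  shows "u = v"
proof
  fix x
  obtain c where c: "x = lc n e c" using is_basisD(3)[OF b] by auto
  have "u x = lc n (u \<circ> e) c" "v x = lc n (v \<circ> e) c"
    unfolding c using assms lin_on_lc[OF _ subsp_UNIV] by (auto simp: lin_on_UNIV)
  moreover have "lc n (u \<circ> e) c = lc n (v \<circ> e) c" by (intro lc_cong) (auto simp: eq)
  ultimately show "u x = v x" by simp
qed

lemma zero_diagonal_sum_nilpotent:
  assumes r: "rep UNIV u n e M" and u: "endomorphism act u" and z: "\<And>i. i < n \<Longrightarrow> M i i = 0"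
  shows "\<exists>a b. endomorphism act a \<and> endomorphism act b \<and> nilpotent a \<and> nilpotent b \<and>
           u = (\<lambda>x. a x + b x)"
proof -
  have b: "is_basis act UNIV n e" using r by (simp add: rep_def)
  obtain a where a: "endomorphism act a" "rep UNIV a n e (\<lambda>i j. if i < j then M i j else 0)"
    using map_of_matrix[OF b] lin_on_UNIV by blast
  obtain b where b': "endomorphism act b" "rep UNIV b n e (\<lambda>i j. if j < i then M i j else 0)"
    using map_of_matrix[OF b] lin_on_UNIV by blast
  have "nilpotent a"
    using a by (intro graded_nilpotent[OF a(2), of "\<lambda>i. i" n]) (auto split: if_splits)
  moreover have "nilpotent b"
    \<comment> \<open>The heights \<open>n - i\<close> run from \<open>1\<close> to
      \<open>n\<close>, hence the bound \<open>Suc n\<close>.\<close>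
    using b' by (intro graded_nilpotent[OF b'(2), of "\<lambda>i. n - i" "Suc n"]) (auto split: if_splits)
  moreover have "u = (\<lambda>x. a x + b x)"
  proof (rule endomorphism_eqI[OF b u])
    show "endomorphism act (\<lambda>x. a x + b x)"
      using a(1) b'(1) by (simp add: endomorphism_def act_add_left add_ac)
    show "u (e j) = a (e j) + b (e j)" if "j < n" for j
      using that r a(2) b'(2) z by (auto simp: rep_def lc_add intro!: lc_cong)
  qed
  ultimately show ?thesis using a b' by blast
qed

end

section \<open>Endomorphisms over a quaternion algebra\<close>

locale quaternionic_space = quaternion_division_algebra scale + right_vector_space act
  for scale :: "'f::field \<Rightarrow> 'q::division_ring \<Rightarrow> 'q"
    and act :: "'v::ab_group_add \<Rightarrow> 'q \<Rightarrow> 'v"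
begin

text \<open>With change-of-basis matrices \<open>P\<close> and \<open>R\<close>,
  \<open>N = R M P\<close> and \<open>P R\<close> is the identity. Factors may be rotated only under
  \<open>tq\<close>, so it is applied to each summand before reordering. The sizes \<open>n\<close>
  and \<open>m\<close> are kept apart because \<open>endo_reduced_trace\<close> quantifies over the
  size too.\<close>

lemma trace_independent_of_basis:
  assumes M: "rep W u n e M" and N: "rep W u m f N" and u: "lin_on W u"
  shows "tq (\<Sum>i<m. N i i) = tq (\<Sum>i<n. M i i)"
proof -
  have e: "is_basis act W n e" and f: "is_basis act W m f"
    using M N by (auto simp: rep_def)
  have "\<forall>j. \<exists>c. j < m \<longrightarrow> f j = lc n e c" "\<forall>j. \<exists>c. j < n \<longrightarrow> e j = lc m f c"
    using is_basisD(2,3)[OF e] is_basisD(2,3)[OF f] by metis+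
  then obtain P' R' where PR': "\<forall>j. j < m \<longrightarrow> f j = lc n e (P' j)" "\<forall>j. j < n \<longrightarrow> e j = lc m f (R' j)"
    by metis
  define P R where "P i j = P' j i" and "R i j = R' j i" for i j
  have P: "f j = lc n e (\<lambda>i. P i j)" if "j < m" for j using PR'(1) that by (simp add: P_def)
  have R: "e j = lc m f (\<lambda>i. R i j)" if "j < n" for j using PR'(2) that by (simp add: R_def)
  have eR: "lc n e c = lc m f (\<lambda>k. \<Sum>i<n. R k i * c i)" for c
  proof -
    have "lc n e c = lc n (\<lambda>i. lc m f (\<lambda>k. R k i)) c" by (intro lc_cong) (auto simp: R)
    then show ?thesis by (simp add: lc_lc)
  qed
  have fP: "lc m f c = lc n e (\<lambda>k. \<Sum>i<m. P k i * c i)" for c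
  proof -
    have "lc m f c = lc m (\<lambda>i. lc n e (\<lambda>k. P k i)) c" by (intro lc_cong) (auto simp: P)
    then show ?thesis by (simp add: lc_lc)
  qed
  have PR: "(\<Sum>k<m. P i k * R k l) = (if i = l then 1 else 0)" if "i < n" "l < n" for i l
  proof -
    have "lc n e (\<lambda>i. if i = l then 1 else 0) = lc n e (\<lambda>i. \<Sum>k<m. P i k * R k l)"
      using that R[of l] lc_single[of l n e 1] by (simp add: act_one fP)
    from lc_unique[OF e this \<open>i < n\<close>] show ?thesis by simp
  qed
  have NRMP: "N k j = (\<Sum>i<n. R k i * (\<Sum>l<n. M i l * P l j))" if "k < m" "j < m" for k j
  proof -
    have "u (f j) = lc n (u \<circ> e) (\<lambda>l. P l j)"
      unfolding P[OF \<open>j < m\<close>] using is_basisD(1,2)[OF e] by (intro lin_on_lc[OF u]) auto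
    also have "\<dots> = lc n (\<lambda>l. lc n e (\<lambda>i. M i l)) (\<lambda>l. P l j)"
      using M by (intro lc_cong) (auto simp: rep_def)
    also have "\<dots> = lc n e (\<lambda>i. \<Sum>l<n. M i l * P l j)" by (rule lc_lc)
    also have "\<dots> = lc m f (\<lambda>k. \<Sum>i<n. R k i * (\<Sum>l<n. M i l * P l j))" by (rule eR)
    finally have "lc m f (\<lambda>k. N k j) = lc m f (\<lambda>k. \<Sum>i<n. R k i * (\<Sum>l<n. M i l * P l j))"
      using N that by (simp add: rep_def)
    from lc_unique[OF f this \<open>k < m\<close>] show ?thesis .
  qed
  have "tq (\<Sum>k<m. N k k) = (\<Sum>k<m. \<Sum>i<n. \<Sum>l<n. tq (R k i * (M i l * P l k)))"
    by (simp add: NRMP tq_sum sum_distrib_left)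
  also have "\<dots> = (\<Sum>k<m. \<Sum>i<n. \<Sum>l<n. tq (M i l * (P l k * R k i)))"
    by (simp add: tq_mult_commute[of "R _ _"] mult.assoc)
  also have "\<dots> = (\<Sum>i<n. \<Sum>k<m. \<Sum>l<n. tq (M i l * (P l k * R k i)))"
    by (rule sum.swap)
  also have "\<dots> = (\<Sum>i<n. \<Sum>l<n. \<Sum>k<m. tq (M i l * (P l k * R k i)))"
    by (intro sum.cong refl sum.swap)
  also have "\<dots> = (\<Sum>i<n. \<Sum>l<n. tq (M i l * (\<Sum>k<m. P l k * R k i)))"
    by (simp add: tq_sum sum_distrib_left)
  also have "\<dots> = (\<Sum>i<n. \<Sum>l<n. if l = i then tq (M i l) else 0)"
    by (intro sum.cong refl) (auto simp: PR tq_on_Z Z_0)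
  also have "\<dots> = tq (\<Sum>i<n. M i i)"
    by (simp add: tq_sum)
  finally show ?thesis .
qed

lemma endo_reduced_trace_eq:
  assumes "represented_by act u n e M" "endomorphism act u"
  shows "endo_reduced_trace scale act u = tq (\<Sum>i<n. M i i)"
  unfolding endo_reduced_trace_def matrix_reduced_trace_def reduced_trace_eq
proof (rule the_equality)
  show "\<exists>n' e M'. represented_by act u n' e M' \<and> tq (\<Sum>i<n. M i i) = tq (\<Sum>i<n'. M' i i)"
    using assms(1) by blast
  show "t = tq (\<Sum>i<n. M i i)"
    if "\<exists>n e M. represented_by act u n e M \<and> t = tq (\<Sum>i<n. M i i)" for t
    using that assms trace_independent_of_basis
    by (metis (no_types) lin_on_UNIV rep_UNIV)
qed

text \<open>In a basis starting with a kernel vector \<open>w\<close>, the first column is zero, and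
  the compression along \<open>w\<close> is nilpotent with the same exponent.\<close>

lemma nilpotent_trace_zero:
  assumes "rep W a n e M" "lin_on W a" "\<And>w. w \<in> W \<Longrightarrow> (a ^^ k) w = 0"
  shows "tq (\<Sum>i<n. M i i) = 0"
  using assms
proof (induction n arbitrary: W a e M)
  case 0
  show ?case by (simp add: tq_on_Z Z_0)
next
  case (Suc m)
  have e: "is_basis act W (Suc m) e" using Suc.prems(1) by (simp add: rep_def)
  have W: "subsp W" using e by (rule is_basisD)
  have e0: "e 0 \<in> W" using is_basisD(2)[OF e] by simp
  have "e 0 \<noteq> 0"
  proof
    assume "e 0 = 0"
    then have "lc (Suc m) e (\<lambda>i. if i = 0 then 1 else 0) = 0" by (simp add: lc_single)
    then have "(if (0::nat) = 0 then 1 else 0) = (0::'q)" using is_basisD(4)[OF e] by blast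
    then show False by simp
  qed
  note lin = Suc.prems(2)
  have powW: "(a ^^ j) w \<in> W" if "w \<in> W" for j w
    using that by (induction j) (auto simp: lin_on_mem[OF Suc.prems(2)])
  \<comment> \<open>The last nonzero vector in the orbit of \<open>e 0\<close> is the kernel
    vector.\<close>
  define j where "j = (LEAST j. (a ^^ j) (e 0) = 0)"
  have j: "(a ^^ j) (e 0) = 0"
    unfolding j_def using Suc.prems(3)[OF e0] by (rule LeastI)
  with \<open>e 0 \<noteq> 0\<close> obtain i where i: "j = Suc i" by (cases j) auto
  define w where "w = (a ^^ i) (e 0)"
  have "w \<noteq> 0"
    unfolding w_def using not_less_Least[of i "\<lambda>j. (a ^^ j) (e 0) = 0"] i by (auto simp: j_def)
  have wW: "w \<in> W" unfolding w_def by (rule powW[OF e0])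
  have aw: "a w = 0" using j i by (simp add: w_def)
  have "family_independent act 1 (\<lambda>_. w)"
    using \<open>w \<noteq> 0\<close> by (simp add: family_independent_def act_eq_0_iff)
  then obtain f where f: "is_basis act W (Suc m) f" and f0: "f 0 = w"
    using basis_extend[OF e, of 1 "\<lambda>_. w"] wW by auto
  obtain N where N: "rep W a (Suc m) f N" using rep_exists[OF f Suc.prems(2)] ..
  let ?W = "family_span act m (f \<circ> Suc)"
  obtain a' where a': "lin_on ?W a'" "rep ?W a' m (f \<circ> Suc) (\<lambda>i j. N (Suc i) (Suc j))"
    and aa': "\<And>w. w \<in> ?W \<Longrightarrow> \<exists>c. a w = act (f 0) c + a' w"
    using compression[OF N Suc.prems(2)] by blast
  \<comment> \<open>Multiples of \<open>f 0 = w\<close> are killed by \<open>a\<close>, so the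
    powers of \<open>a\<close> and \<open>a'\<close> keep differing by a multiple of
    \<open>f 0\<close> only.\<close>
  have pow: "(a' ^^ j) x \<in> ?W \<and> (\<exists>c. (a ^^ j) x = act (f 0) c + (a' ^^ j) x)" if x: "x \<in> ?W" for j x
  proof (induction j)
    case 0
    then show ?case using x by (auto simp: comp_def intro: exI[of _ 0])
  next
    case (Suc j)
    then obtain c where y: "(a' ^^ j) x \<in> ?W" and c: "(a ^^ j) x = act (f 0) c + (a' ^^ j) x" by blast
    obtain d where d: "a ((a' ^^ j) x) = act (f 0) d + a' ((a' ^^ j) x)" using aa'[OF y] by blast
    have "(a' ^^ j) x \<in> W" using y tail_subset[OF f] by blast
    then have "a ((a ^^ j) x) = act (a w) c + a ((a' ^^ j) x)"
      using c wW W f0 lin_on_add[OF lin] lin_on_act[OF lin] subsp_act by metis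
    then show ?case
      using d aw lin_on_mem[OF a'(1) y] by (auto simp: comp_def)
  qed
  have "(a' ^^ k) x = 0" if x: "x \<in> ?W" for x
  proof -
    have "(a ^^ k) x = 0" using x tail_subset[OF f] Suc.prems(3) by blast
    then obtain c where "act (f 0) c + (a' ^^ k) x = 0" using pow[OF x, of k] by auto
    then show ?thesis using head_tail_unique[OF f] pow[OF x, of k] by blast
  qed
  then have 0: "tq (\<Sum>i<m. N (Suc i) (Suc i)) = 0"
    using Suc.IH[OF a'(2,1)] by blast
  have "lc (Suc m) f (\<lambda>i. N i 0) = 0"
    using N aw f0 unfolding rep_def by (metis zero_less_Suc)
  then have "N 0 0 = 0" using is_basisD(4)[OF f, of "\<lambda>i. N i 0" 0] by simp
  then have "tq (\<Sum>i<Suc m. N i i) = 0" using 0 by (subst sum.lessThan_Suc_shift) simp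
  then show ?case using trace_independent_of_basis[OF Suc.prems(1) N Suc.prems(2)] by simp
qed

section \<open>Cyclic triples and the reduction to dimension 3\<close>

definition cyclic3 :: "'v set \<Rightarrow> ('v \<Rightarrow> 'v) \<Rightarrow> bool" where
  "cyclic3 W u \<longleftrightarrow> (\<exists>x\<in>W. family_independent act 3 ((!) [x, u x, u (u x)]))"

definition bicyclic :: "'v set \<Rightarrow> ('v \<Rightarrow> 'v) \<Rightarrow> bool" where
  "bicyclic W u \<longleftrightarrow> (\<exists>x\<in>W. \<exists>y\<in>W. family_independent act 4 ((!) [x, u x, y, u y]))"

lemma lc_3: "lc 3 e c = act (e 0) (c 0) + act (e 1) (c 1) + act (e 2) (c 2)"
  by (simp add: lc_def eval_nat_numeral)

lemma basis_extend_list: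
  assumes "is_basis act W n e" "family_independent act k ((!) xs)" "length xs = k" "set xs \<subseteq> W"
  obtains f where "is_basis act W n f" "\<forall>i<k. f i = xs ! i"
proof -
  have "xs ! i \<in> W" if "i < k" for i using assms(3,4) that nth_mem by blast
  then show thesis using basis_extend[OF assms(1,2)] that by blast
qed

lemma all_less_4: "(\<forall>i<4. P i) \<longleftrightarrow> P 0 \<and> P 1 \<and> P 2 \<and> P (3::nat)"
  by (auto simp: eval_nat_numeral All_less_Suc)

lemma all_less_3: "(\<forall>i<3. P i) \<longleftrightarrow> P 0 \<and> P 1 \<and> P (2::nat)"
  by (auto simp: eval_nat_numeral All_less_Suc)

lemma independent_4_of_basis:
  assumes b: "is_basis act W n e" and ijk: "i < n" "j < n" "k < n" "distinct [i, j, k]"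
    and l: "l < n" "l \<notin> {i, j, k}" "c l \<noteq> 0"
  shows "family_independent act 4 ((!) [e i, e j, e k, lc n e c])"
  unfolding family_independent_4
proof (intro allI impI)
  fix \<alpha> \<beta> \<gamma> \<delta>
  assume "act ([e i, e j, e k, lc n e c] ! 0) \<alpha> + act ([e i, e j, e k, lc n e c] ! 1) \<beta> +
    act ([e i, e j, e k, lc n e c] ! 2) \<gamma> + act ([e i, e j, e k, lc n e c] ! 3) \<delta> = 0"
  then have "lc n e (\<lambda>m. if m = i then \<alpha> else 0) + lc n e (\<lambda>m. if m = j then \<beta> else 0)
      + lc n e (\<lambda>m. if m = k then \<gamma> else 0) + act (lc n e c) \<delta> = 0"
    using ijk by (simp add: lc_single)
  then have 0: "(if m = i then \<alpha> else 0) + (if m = j then \<beta> else 0) + (if m = k then \<gamma> else 0) + c m * \<delta> = 0"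
    if "m < n" for m
    unfolding lc_act lc_add using is_basisD(4)[OF b _ that] by blast
  have "\<delta> = 0" using 0[OF l(1)] l by auto
  then show "\<alpha> = 0 \<and> \<beta> = 0 \<and> \<gamma> = 0 \<and> \<delta> = 0"
    using 0[OF ijk(1)] 0[OF ijk(2)] 0[OF ijk(3)] ijk(4) by auto
qed

text \<open>Take a fourth basis vector \<open>f 3\<close> as \<open>y\<close>. It fails only if
  \<open>u (f 3)\<close> lies in the span of \<open>x\<close>, \<open>u x\<close> and
  \<open>f 3\<close>; then \<open>f 3 + u x\<close> works.\<close>

lemma cyclic3_imp_bicyclic:
  assumes b: "is_basis act W n e" and n: "4 \<le> n" and u: "lin_on W u" and c3: "cyclic3 W u"
  shows "bicyclic W u"
proof -
  obtain x where x: "x \<in> W" and ind: "family_independent act 3 ((!) [x, u x, u (u x)])"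
    using c3 by (auto simp: cyclic3_def)
  have W: "subsp W" using b by (rule is_basisD)
  have "u x \<in> W" "u (u x) \<in> W" using lin_on_mem[OF u] x by auto
  then obtain f where f: "is_basis act W n f" and "\<forall>i<3. f i = [x, u x, u (u x)] ! i"
    using x ind by (elim basis_extend_list[OF b]) auto
  then have f012: "f 0 = x" "f 1 = u x" "f 2 = u (u x)"
    unfolding all_less_3 by simp_all
  have f3: "f 3 \<in> W" using is_basisD(2)[OF f] n by simp
  obtain c where c: "u (f 3) = lc n f c"
    using basis_coordsE[OF f lin_on_mem[OF u f3]] .
  show ?thesis
  proof (cases "\<exists>l<n. l \<notin> {0, 1, 3} \<and> c l \<noteq> 0")
    case True
    then obtain l where "l < n" "l \<notin> {0, 1, 3}" "c l \<noteq> 0" by blast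
    then have "family_independent act 4 ((!) [f 0, f 1, f 3, lc n f c])"
      using n by (intro independent_4_of_basis[OF f]) auto
    then show ?thesis
      unfolding bicyclic_def c[symmetric] f012(1,2) using x f3 by blast
  next
    case False
    \<comment> \<open>Adding \<open>u x\<close> brings \<open>u (u x) = f 2\<close> into the image,
      with nothing to cancel it since \<open>c 2 = 0\<close>.\<close>
    let ?y = "f 3 + u x"
    have y: "?y \<in> W" "u ?y = u (f 3) + u (u x)"
      using f3 \<open>u x \<in> W\<close> W u by (auto simp: subsp_add lin_on_add)
    have "family_independent act 4 ((!) [x, u x, ?y, u ?y])"
      unfolding family_independent_4
    proof (intro allI impI)
      fix \<alpha> \<beta> \<gamma> \<delta>
      assume "act ([x, u x, ?y, u ?y] ! 0) \<alpha> + act ([x, u x, ?y, u ?y] ! 1) \<beta> +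
        act ([x, u x, ?y, u ?y] ! 2) \<gamma> + act ([x, u x, ?y, u ?y] ! 3) \<delta> = 0"
      then have "act (f 0) \<alpha> + act (f 1) \<beta> + act (f 3) \<gamma> + act (f 1) \<gamma> + act (lc n f c) \<delta> + act (f 2) \<delta> = 0"
        by (simp del: One_nat_def add: y f012 c act_add_left add.assoc)
      then have "lc n f (\<lambda>m. if m = 0 then \<alpha> else 0) + lc n f (\<lambda>m. if m = 1 then \<beta> else 0)
        + lc n f (\<lambda>m. if m = 3 then \<gamma> else 0) + lc n f (\<lambda>m. if m = 1 then \<gamma> else 0)
        + lc n f (\<lambda>m. c m * \<delta>) + lc n f (\<lambda>m. if m = 2 then \<delta> else 0) = 0"
        using n by (simp add: lc_single lc_act)
      then have 0: "(if m = 0 then \<alpha> else 0) + (if m = 1 then \<beta> else 0) + (if m = 3 then \<gamma> else 0)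
          + (if m = 1 then \<gamma> else 0) + c m * \<delta> + (if m = 2 then \<delta> else 0) = 0" if "m < n" for m
        unfolding lc_add using is_basisD(4)[OF f _ that] by blast
      have "\<not> (2 < n \<and> 2 \<notin> {0, 1, 3 :: nat} \<and> c 2 \<noteq> 0)" using False by blast
      then have "c 2 = 0" using n by simp
      then have "\<delta> = 0" using 0[of 2] n by simp
      then have "\<gamma> = 0" using 0[of 3] n by simp
      with \<open>\<delta> = 0\<close> show "\<alpha> = 0 \<and> \<beta> = 0 \<and> \<gamma> = 0 \<and> \<delta> = 0"
        using 0[of 0] 0[of 1] n by simp
    qed
    then show ?thesis unfolding bicyclic_def using x y by blast
  qed
qed

text \<open>The basis starts with \<open>x, u x, y, u y + x d\<close>; the choice of \<open>d\<close> makes \<open>y\<close> generate a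
  three-dimensional cyclic subspace for the compression along \<open>x\<close>.\<close>

lemma bicyclic_compression:
  assumes b: "is_basis act W (Suc m) e" and m: "3 \<le> m" and u: "lin_on W u" and g4: "bicyclic W u"
  shows "\<exists>f u'. is_basis act W (Suc m) f \<and> u (f 0) = f 1 \<and>
    lin_on (family_span act m (f \<circ> Suc)) u' \<and> cyclic3 (family_span act m (f \<circ> Suc)) u' \<and>
    (\<forall>M. rep W u (Suc m) f M \<longrightarrow>
       rep (family_span act m (f \<circ> Suc)) u' m (f \<circ> Suc) (\<lambda>i j. M (Suc i) (Suc j))) \<and>
    (\<forall>w\<in>family_span act m (f \<circ> Suc). \<exists>c. u w = act (f 0) c + u' w)"
proof -
  obtain x y where x: "x \<in> W" and y: "y \<in> W" and ind: "family_independent act 4 ((!) [x, u x, y, u y])"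
    using g4 by (auto simp: bicyclic_def)
  have W: "subsp W" using b by (rule is_basisD)
  have "u x \<in> W" "u y \<in> W" using lin_on_mem[OF u] x y by auto
  then obtain g where g: "is_basis act W (Suc m) g" and "\<forall>i<4. g i = [x, u x, y, u y] ! i"
    using x y ind by (elim basis_extend_list[OF b]) auto
  then have g0123: "g 0 = x" "g 1 = u x" "g 2 = y" "g 3 = u y"
    unfolding all_less_4 by simp_all
  obtain a where a: "u (u y) = lc (Suc m) g a"
    using basis_coordsE[OF g lin_on_mem[OF u \<open>u y \<in> W\<close>]] .
  \<comment> \<open>Once \<open>u y\<close> is replaced by \<open>u y + x d\<close>, the coefficient
    of \<open>u x\<close> in the image of the new vector is \<open>a 1 + d\<close>; it has to be
    nonzero.\<close>
  define d :: 'q where "d = (if a 1 = 0 then 1 else 0)"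
  have d: "a 1 + d \<noteq> 0" by (simp add: d_def)
  define k where "k i = (if i = 0 then d else if i = 3 then 1 else 0)" for i :: nat
  have "k = (\<lambda>i. (if i = 0 then d else 0) + (if i = 3 then 1 else 0))"
    by (auto simp: k_def)
  then have lk: "lc (Suc m) g k = act x d + u y"
    using m by (simp only: lc_add[symmetric]) (simp add: lc_single g0123 act_one)
  define f where "f = g(3 := lc (Suc m) g k)"
  have f: "is_basis act W (Suc m) f"
    unfolding f_def using m by (intro is_basis_exchange[OF g]) (auto simp: k_def)
  have f0123: "f 0 = x" "f 1 = u x" "f 2 = y" "f 3 = act x d + u y"
    using g0123 lk by (auto simp: f_def)
  have uf3: "u (f 3) = act (u x) d + u (u y)"
    unfolding f0123 using x \<open>u y \<in> W\<close> W u by (simp add: lin_on_add lin_on_act subsp_act)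
  obtain M where M: "rep W u (Suc m) f M" using rep_exists[OF f u] ..
  let ?W = "family_span act m (f \<circ> Suc)"
  have bW: "is_basis act ?W m (f \<circ> Suc)" using f by (rule is_basis_tail)
  obtain u' where u': "lin_on ?W u'" "rep ?W u' m (f \<circ> Suc) (\<lambda>i j. M (Suc i) (Suc j))"
    and uu': "\<And>w. w \<in> ?W \<Longrightarrow> \<exists>c. u w = act (f 0) c + u' w"
    using compression[OF M u] by blast
  have fW: "f i \<in> ?W" if "0 < i" "i \<le> m" for i
    using is_basisD(2)[OF bW, of "i - 1"] that by simp
  have fW: "f 1 \<in> ?W" "f 2 \<in> ?W" "f 3 \<in> ?W" using fW m by auto
  have sub: "subsp ?W" by (rule subsp_family_span)
  \<comment> \<open>Uniqueness of the splitting into a multiple of \<open>f 0\<close> and a tail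
    vector lets values of \<open>u'\<close> be read off from those of \<open>u\<close>.\<close>
  have decomp: "u' w = v" if "w \<in> ?W" "v \<in> ?W" "u w = act (f 0) c + v" for w v c
  proof -
    obtain c' where "u w = act (f 0) c' + u' w" using uu' \<open>w \<in> ?W\<close> by blast
    then have "act (f 0) (c' - c) + (u' w - v) = 0"
      using that(3) by (simp add: act_diff_right algebra_simps)
    then show ?thesis
      using head_tail_unique[OF f] subsp_diff[OF sub lin_on_mem[OF u'(1) that(1)] that(2)]
      by (metis eq_iff_diff_eq_0)
  qed
  have u'f2: "u' (f 2) = f 3"
    using fW by (intro decomp[where c = "- d"]) (auto simp: f0123 act_minus_right)
  obtain h where h: "u' (f 3) = lc m (f \<circ> Suc) h"
    using basis_coordsE[OF bW lin_on_mem[OF u'(1) fW(3)]] .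
  \<comment> \<open>Index \<open>0\<close> of the tail belongs to \<open>f 1 = u x\<close>, so
    \<open>h 0\<close> is \<open>a 1 + d\<close>: passing from \<open>g\<close> to \<open>f\<close>
    changes the coefficients \<open>a\<close> only along \<open>f 0\<close>.\<close>
  have h0: "h 0 \<noteq> 0"
  proof -
    obtain c where "u (f 3) = act (f 0) c + u' (f 3)" using uu' fW by blast
    then have 1: "u (f 3) = lc (Suc m) f (case_nat c h)"
      using h by (simp add: lc_Suc_shift comp_def)
    define a' where "a' i = a i - (if i = 0 then d * a 3 else 0) + (if i = 1 then d else 0)" for i
    have ga: "lc (Suc m) g a = lc (Suc m) f a - act (f 0) (d * a 3)"
    proof -
      have "lc (Suc m) f a = (\<Sum>i<Suc m. act (g i) (a i) + (if i = 3 then act (f 3 - g 3) (a 3) else 0))"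
        unfolding lc_def by (intro sum.cong) (auto simp: f_def act_diff_left)
      also have "\<dots> = lc (Suc m) g a + act (f 3 - g 3) (a 3)"
        unfolding sum.distrib using m by (simp add: lc_def)
      finally show ?thesis by (simp add: f0123 g0123 act_mult)
    qed
    have "u (f 3) = lc (Suc m) f a - act (f 0) (d * a 3) + act (f 1) d"
      unfolding uf3 a ga f0123(2) by simp
    also have "\<dots> = lc (Suc m) f a'"
      unfolding a'_def lc_add[symmetric] lc_diff[symmetric] using m by (simp add: lc_single)
    finally have "lc (Suc m) f (case_nat c h) = lc (Suc m) f a'" using 1 by simp
    from lc_unique[OF f this, of 1] have "h 0 = a 1 + d" using m by (simp add: a'_def)
    then show ?thesis using d by simp
  qed
  have "family_independent act 3 ((!) [f 2, f 3, u' (f 3)])"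
    unfolding family_independent_3
  proof (intro allI impI)
    fix \<alpha> \<beta> \<gamma>
    assume "act ([f 2, f 3, u' (f 3)] ! 0) \<alpha> + act ([f 2, f 3, u' (f 3)] ! 1) \<beta>
      + act ([f 2, f 3, u' (f 3)] ! 2) \<gamma> = 0"
    then have "act ((f \<circ> Suc) 1) \<alpha> + act ((f \<circ> Suc) 2) \<beta> + act (lc m (f \<circ> Suc) h) \<gamma> = 0"
      unfolding h[symmetric] by (simp add: eval_nat_numeral)
    then have "lc m (f \<circ> Suc) (\<lambda>i. (if i = 1 then \<alpha> else 0) + (if i = 2 then \<beta> else 0) + h i * \<gamma>) = 0"
      unfolding lc_add[symmetric] lc_act[symmetric] using m by (simp add: lc_single)
    then have 0: "(if i = 1 then \<alpha> else 0) + (if i = 2 then \<beta> else 0) + h i * \<gamma> = 0" if "i < m" for i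
      using is_basisD(4)[OF bW _ that] by blast
    have "\<gamma> = 0" using 0[of 0] h0 m by simp
    then show "\<alpha> = 0 \<and> \<beta> = 0 \<and> \<gamma> = 0" using 0[of 1] 0[of 2] m by simp
  qed
  then have "cyclic3 ?W u'"
    unfolding cyclic3_def using fW u'f2 by (intro bexI[of _ "f 2"]) auto
  moreover have "rep ?W u' m (f \<circ> Suc) (\<lambda>i j. N (Suc i) (Suc j))" if N: "rep W u (Suc m) f N" for N
  proof -
    have "N i j = M i j" if "i < Suc m" "j < Suc m" for i j
      using N M that by (intro lc_unique[OF f, of "\<lambda>i. N i j" "\<lambda>i. M i j"]) (auto simp: rep_def)
    then show ?thesis
      using u'(2) by (auto simp: rep_def intro!: lc_cong)
  qed
  moreover have "u (f 0) = f 1" unfolding f0123 ..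
  ultimately show ?thesis
    using f u'(1) uu' by (intro exI[of _ f] exI[of _ u'] conjI) blast+
qed

text \<open>Modulo \<open>x\<close>, the matrix of \<open>u\<close> in the basis \<open>y, t + x d\<close> has columns \<open>(0, 1)\<close> and
  \<open>(d', c)\<close>, where \<open>d' = b + d\<close> is at our disposal. The choice \<open>d' = p p' + k\<close>, where
  \<open>p' = p + c\<close> and \<open>k p' = p k\<close>, makes \<open>u (u z)\<close> a multiple of \<open>z = y p + t + x d\<close>
  modulo \<open>x\<close>.\<close>

lemma cyclic3_zero_diagonal_3:
  assumes M: "rep W u 3 e M" and u: "lin_on W u" and c3: "cyclic3 W u"
    and tr: "tq (\<Sum>i<3. M i i) = 0"
  shows "\<exists>f. zero_diagonal W u 3 f"
proof -
  obtain x where x: "x \<in> W" and ind: "family_independent act 3 ((!) [x, u x, u (u x)])"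
    using c3 by (auto simp: cyclic3_def)
  have e: "is_basis act W 3 e" using M by (simp add: rep_def)
  have W: "subsp W" using e by (rule is_basisD)
  define y where "y = u x"
  define t where "t = u y"
  have yW: "y \<in> W" and tW: "t \<in> W" using lin_on_mem[OF u] x by (auto simp: y_def t_def)
  let ?f = "(!) [x, y, t]"
  have f: "is_basis act W 3 ?f"
  proof (rule independent_imp_basis[OF e])
    show "?f i \<in> W" if "i < 3" for i
      using that x yW tW all_less_3[of "\<lambda>i. ?f i \<in> W"] by simp
  qed (use ind in \<open>simp add: y_def t_def\<close>)
  obtain N where N: "rep W u 3 ?f N" using rep_exists[OF f u] ..
  have col: "u (?f j) = act x (N 0 j) + act y (N 1 j) + act t (N 2 j)" if "j < 3" for j
    using N that by (simp add: rep_def lc_3)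
  define a b c where "a = N 0 2" and "b = N 1 2" and "c = N 2 2"
  have ut: "u t = act x a + act y b + act t c"
    using col[of 2] by (simp add: a_def b_def c_def)
  have indD: "\<alpha> = 0 \<and> \<beta> = 0 \<and> \<gamma> = 0" if "act x \<alpha> + act y \<beta> + act t \<gamma> = 0" for \<alpha> \<beta> \<gamma>
    using ind that unfolding family_independent_3 y_def t_def by simp
  have "act x (N 0 0) + act y (N 1 0 - 1) + act t (N 2 0) = 0"
    using col[of 0] by (simp add: act_diff_right act_one y_def algebra_simps)
  then have N00: "N 0 0 = 0" using indD by blast
  have "act x (N 0 1) + act y (N 1 1) + act t (N 2 1 - 1) = 0"
    using col[of 1] by (simp add: act_diff_right act_one t_def algebra_simps)
  then have N11: "N 1 1 = 0" using indD by blast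
  \<comment> \<open>In the basis \<open>x, u x, u (u x)\<close> the matrix is a companion matrix
    with diagonal \<open>0, 0, c\<close>.\<close>
  have "tq (\<Sum>i<3. N i i) = 0"
    using trace_independent_of_basis[OF M N u] tr by simp
  moreover have "(\<Sum>i<3. N i i) = c"
    using N00 N11 by (simp add: c_def eval_nat_numeral)
  ultimately have tc: "tq c = 0" by simp
  show ?thesis
  proof (cases "c = 0")
    case True
    have "zero_diagonal W u 3 ?f"
      unfolding zero_diagonal_def all_less_3
    proof (intro conjI f)
      show "\<exists>h. h 0 = 0 \<and> u (?f 0) = lc 3 ?f h"
        by (rule exI[of _ "(!) [0, 1, 0]"]) (simp add: lc_3 act_one y_def)
      show "\<exists>h. h 1 = 0 \<and> u (?f 1) = lc 3 ?f h"
        by (rule exI[of _ "(!) [0, 0, 1]"]) (simp add: lc_3 act_one t_def)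
      show "\<exists>h. h 2 = 0 \<and> u (?f 2) = lc 3 ?f h"
        by (rule exI[of _ "(!) [a, b, 0]"]) (simp add: lc_3 ut True)
    qed
    then show ?thesis by blast
  next
    case False
    obtain k p where k: "k \<noteq> 0" and kp: "k * (p + c) = p * k"
      using trace_zero_commutator[OF tc False] by blast
    define p' d' where "p' = p + c" and "d' = p * p' + k"
    define d s where "d = d' - b" and "s = d' + c * p'"
    \<comment> \<open>This proportionality makes \<open>y (d' * p') + t s\<close>, which is
      \<open>u w\<close> modulo \<open>x\<close>, equal to \<open>(y p + t) s\<close>.\<close>
    have key: "d' * p' = p * s"
    proof -
      have "p' * p' = p * p' + c * p'" by (simp add: p'_def distrib_right)
      then show ?thesis
        using kp by (simp add: d'_def s_def distrib_left distrib_right mult.assoc flip: p'_def)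
    qed
    define z w where "z = act x d + act y p + t" and "w = act x (d * p') + act y d' + act t p'"
    let ?g = "(!) [x, z, w]"
    have zW: "z \<in> W" and wW: "w \<in> W"
      unfolding z_def w_def using x yW tW by (auto intro!: subsp_add[OF W] subsp_act[OF W])
    have g: "is_basis act W 3 ?g"
    proof (rule independent_imp_basis[OF e])
      show "?g i \<in> W" if "i < 3" for i
        using that x zW wW all_less_3[of "\<lambda>i. ?g i \<in> W"] by simp
      show "family_independent act 3 ?g"
        unfolding family_independent_3
      proof (intro allI impI)
        fix \<alpha> \<beta> \<gamma>
        assume "act (?g 0) \<alpha> + act (?g 1) \<beta> + act (?g 2) \<gamma> = 0"
        then have "act x (\<alpha> + d * \<beta> + d * p' * \<gamma>) + act y (p * \<beta> + d' * \<gamma>) + act t (\<beta> + p' * \<gamma>) = 0"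
          by (simp add: z_def w_def act_simps algebra_simps)
        from indD[OF this] have 0: "\<alpha> + d * \<beta> + d * p' * \<gamma> = 0" "p * \<beta> + d' * \<gamma> = 0" "\<beta> + p' * \<gamma> = 0"
          by auto
        from 0(3) have \<beta>: "\<beta> = - (p' * \<gamma>)" by (simp add: eq_neg_iff_add_eq_0)
        \<comment> \<open>Modulo \<open>x\<close>, \<open>k\<close> is the obstruction to
          independence of \<open>z\<close> and \<open>w\<close>: subtracting \<open>p * p'\<close>
          from \<open>d'\<close> leaves just \<open>k\<close>.\<close>
        with 0(2) have "k * \<gamma> = 0" by (simp add: d'_def algebra_simps)
        then have "\<gamma> = 0" using k by simp
        with \<beta> 0(1) show "\<alpha> = 0 \<and> \<beta> = 0 \<and> \<gamma> = 0" by simp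
      qed
    qed
    have uz: "u z = w + act x (a - d * p')"
    proof -
      have "u z = act y d + act t p + u t"
        unfolding z_def using x yW tW W
        by (simp add: lin_on_add[OF u] lin_on_act[OF u] subsp_add subsp_act flip: y_def t_def)
      then show ?thesis
        unfolding ut w_def p'_def d_def by (simp add: act_simps algebra_simps)
    qed
    have uw: "u w = act z s + act x (a * p' - d * s)"
    proof -
      have "u w = act y (d * p') + act t d' + act (u t) p'"
        unfolding w_def using x yW tW W
        by (simp add: lin_on_add[OF u] lin_on_act[OF u] subsp_add subsp_act flip: y_def t_def)
      also have "\<dots> = act x (a * p') + act y (d' * p') + act t s"
        unfolding ut d_def s_def by (simp add: act_simps algebra_simps)
      also have "\<dots> = act z s + act x (a * p' - d * s)"
        unfolding z_def key by (simp add: act_simps algebra_simps)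
      finally show ?thesis .
    qed
    \<comment> \<open>Thus \<open>u x = y\<close> is a combination of \<open>z\<close> and
      \<open>w\<close> with no \<open>x\<close> component, which gives the first zero on the
      diagonal.\<close>
    have yk: "act y k = w - act z p'"
      unfolding z_def w_def d'_def by (simp add: act_simps algebra_simps)
    have "y = act (act y k) (inverse k)"
      using k by (simp add: act_simps)
    then have ux: "u x = act z (- p' * inverse k) + act w (inverse k)"
      unfolding yk by (simp add: act_simps flip: y_def)
    have "zero_diagonal W u 3 ?g"
      unfolding zero_diagonal_def all_less_3
    proof (intro conjI g)
      show "\<exists>h. h 0 = 0 \<and> u (?g 0) = lc 3 ?g h"
        by (rule exI[of _ "(!) [0, - p' * inverse k, inverse k]"]) (simp add: lc_3 ux)
      show "\<exists>h. h 1 = 0 \<and> u (?g 1) = lc 3 ?g h"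
        by (rule exI[of _ "(!) [a - d * p', 0, 1]"]) (simp add: lc_3 uz act_one)
      show "\<exists>h. h 2 = 0 \<and> u (?g 2) = lc 3 ?g h"
        by (rule exI[of _ "(!) [a * p' - d * s, s, 0]"]) (simp add: lc_3 uw)
    qed
    then show ?thesis by blast
  qed
qed

text \<open>Since \<open>u (f 0) = f 1\<close>, the first diagonal entry is zero and the compression
  inherits trace zero. The induction hypothesis is an assumption so that the lemma serves both
  inside the induction on cyclic triples and for bicyclic maps without one.\<close>

lemma bicyclic_step:
  assumes IH: "\<And>W u e M. rep W u m e M \<Longrightarrow> lin_on W u \<Longrightarrow> cyclic3 W u \<Longrightarrow>
      tq (\<Sum>i<m. M i i) = 0 \<Longrightarrow> \<exists>f. zero_diagonal W u m f"
    and m: "3 \<le> m" and M: "rep W u (Suc m) e M" and u: "lin_on W u" and g4: "bicyclic W u"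
    and tr: "tq (\<Sum>i<Suc m. M i i) = 0"
  shows "\<exists>f. zero_diagonal W u (Suc m) f"
proof -
  have e: "is_basis act W (Suc m) e" using M by (simp add: rep_def)
  obtain f u' where f: "is_basis act W (Suc m) f" and f01: "u (f 0) = f 1"
    and u': "lin_on (family_span act m (f \<circ> Suc)) u'"
    and c3: "cyclic3 (family_span act m (f \<circ> Suc)) u'"
    and N': "\<And>M. rep W u (Suc m) f M \<Longrightarrow>
       rep (family_span act m (f \<circ> Suc)) u' m (f \<circ> Suc) (\<lambda>i j. M (Suc i) (Suc j))"
    and uu': "\<And>w. w \<in> family_span act m (f \<circ> Suc) \<Longrightarrow> \<exists>c. u w = act (f 0) c + u' w"
    using bicyclic_compression[OF e m u g4] by blast
  obtain N where N: "rep W u (Suc m) f N" using rep_exists[OF f u] ..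
  have "lc (Suc m) f (\<lambda>i. N i 0) = lc (Suc m) f (\<lambda>i. if i = 1 then 1 else 0)"
    using N m f01 by (simp add: rep_def lc_single act_one)
  from lc_unique[OF f this, of 0] have N00: "N 0 0 = 0" by simp
  have "tq (\<Sum>i<Suc m. N i i) = 0"
    using trace_independent_of_basis[OF M N u] tr by simp
  then have "tq (\<Sum>i<m. N (Suc i) (Suc i)) = 0"
    unfolding sum.lessThan_Suc_shift by (simp add: N00)
  then obtain g where g: "zero_diagonal (family_span act m (f \<circ> Suc)) u' m g"
    using IH[OF N'[OF N] u' c3] by blast
  have "u (f 0) \<in> family_span act m (f \<circ> Suc)"
    using is_basisD(2)[OF is_basis_tail[OF f], of 0] m f01 by simp
  from zero_diagonal_lift[OF f this g uu'] show ?thesis by blast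
qed

lemma cyclic3_zero_diagonal:
  assumes "3 \<le> m" "rep W u m e M" "lin_on W u" "cyclic3 W u" "tq (\<Sum>i<m. M i i) = 0"
  shows "\<exists>f. zero_diagonal W u m f"
  using assms
proof (induction m arbitrary: W u e M rule: dec_induct)
  case base
  then show ?case by (intro cyclic3_zero_diagonal_3)
next
  case (step m)
  have "bicyclic W u"
    using step.prems step.hyps by (intro cyclic3_imp_bicyclic[of W "Suc m" e u]) (auto simp: rep_def)
  with step show ?case by (intro bicyclic_step[of m W u e M]) auto
qed

lemma bicyclic_zero_diagonal:
  assumes "4 \<le> m" "rep W u m e M" "lin_on W u" "bicyclic W u" "tq (\<Sum>i<m. M i i) = 0"
  shows "\<exists>f. zero_diagonal W u m f"
proof -
  obtain k where k: "m = Suc k" "3 \<le> k" using assms(1) by (cases m) auto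
  show ?thesis
    using assms(2-) unfolding k(1)
    by (intro bicyclic_step[OF _ k(2), of W u e M] cyclic3_zero_diagonal[OF k(2)])
qed

subsection \<open>Endomorphisms without cyclic vectors\<close>

text \<open>Modulo \<open>S\<close> every vector is an eigenvector. Independent vectors share their
  eigenvalue, as their sum shows; but replacing a vector by a multiple conjugates its eigenvalue, so
  the common value is central.\<close>

lemma scalar_modulo_subspace:
  assumes S: "subsp S" and u: "endomorphism act u"
    and ind: "\<And>\<alpha> \<beta>. act y1 \<alpha> + act y2 \<beta> \<in> S \<Longrightarrow> \<alpha> = 0 \<and> \<beta> = 0"
    and ev: "\<And>y. y \<notin> S \<Longrightarrow> \<exists>q. u y - act y q \<in> S"
  shows "\<exists>\<mu>\<in>Z. \<forall>y. u y - act y \<mu> \<in> S"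
proof -
  have uadd: "u (x + y) = u x + u y" and uact: "u (act x q) = act (u x) q" for x y q
    using u by (auto simp: endomorphism_def)
  have same: "q = q'"
    if yz: "\<And>\<alpha> \<beta>. act y \<alpha> + act z \<beta> \<in> S \<Longrightarrow> \<alpha> = 0 \<and> \<beta> = 0"
      and q: "u y - act y q \<in> S" and q': "u z - act z q' \<in> S" for y z q q'
  proof -
    have "y + z \<notin> S" using yz[of 1 1] by (auto simp: act_one)
    then obtain p where p: "u (y + z) - act (y + z) p \<in> S" using ev by blast
    have "act y (q - p) + act z (q' - p)
        = (u (y + z) - act (y + z) p) - (u y - act y q) - (u z - act z q')"
      by (simp add: uadd act_simps)
    then have "act y (q - p) + act z (q' - p) \<in> S"
      using S p q q' by (simp add: subsp_diff)
    then show ?thesis using yz by fastforce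
  qed
  have y12: "y1 \<notin> S" "y2 \<notin> S"
    using ind[of 1 0] ind[of 0 1] by (auto simp: act_one)
  then obtain \<mu> q2 where \<mu>: "u y1 - act y1 \<mu> \<in> S" and q2: "u y2 - act y2 q2 \<in> S"
    using ev by blast
  have "\<mu> = q2" using ind \<mu> q2 by (rule same)
  \<comment> \<open>\<open>y2 r\<close> has eigenvalue \<open>inverse r * \<mu> * r\<close> and is
    still independent of \<open>y1\<close> modulo \<open>S\<close>.\<close>
  have "\<mu> * r = r * \<mu>" for r
  proof (cases "r = 0")
    case False
    have "u (act y2 r) - act (act y2 r) (inverse r * \<mu> * r) = act (u y2 - act y2 \<mu>) r"
      using False by (simp add: uact act_simps) (simp flip: mult.assoc add: False)
    then have 1: "u (act y2 r) - act (act y2 r) (inverse r * \<mu> * r) \<in> S"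
      using subsp_act[OF S q2] \<open>\<mu> = q2\<close> by simp
    have "\<mu> = inverse r * \<mu> * r"
    proof (rule same[OF _ \<mu> 1])
      show "\<alpha> = 0 \<and> \<beta> = 0" if "act y1 \<alpha> + act (act y2 r) \<beta> \<in> S" for \<alpha> \<beta>
        using ind[of \<alpha> "r * \<beta>"] that False by (simp add: act_simps)
    qed
    then have "r * \<mu> = r * (inverse r * \<mu> * r)" by simp
    then show ?thesis using False by (simp flip: mult.assoc)
  qed simp
  then have \<mu>Z: "\<mu> \<in> Z" by (simp add: Z_iff)
  \<comment> \<open>The assumption \<open>ev\<close> says nothing on \<open>S\<close> itself; a
    vector \<open>s\<close> of \<open>S\<close> is the difference of \<open>y1 + s\<close> and
    \<open>y1\<close>, both outside.\<close>
  have onS: "u s - act s \<mu> \<in> S" if s: "s \<in> S" for s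
  proof -
    have ind': "\<alpha> = 0 \<and> \<beta> = 0" if "act (y1 + s) \<alpha> + act y2 \<beta> \<in> S" for \<alpha> \<beta>
    proof -
      have "act y1 \<alpha> + act y2 \<beta> = (act (y1 + s) \<alpha> + act y2 \<beta>) - act s \<alpha>"
        by (simp add: act_simps)
      also have "\<dots> \<in> S" using that s by (intro subsp_diff[OF S] subsp_act[OF S])
      finally have "act y1 \<alpha> + act y2 \<beta> \<in> S" .
      then show ?thesis by (rule ind)
    qed
    have "y1 + s \<notin> S" using ind'[of 1 0] by (auto simp: act_one)
    then obtain q where q: "u (y1 + s) - act (y1 + s) q \<in> S" using ev by blast
    have "q = q2" using ind' q q2 by (rule same)
    then have "u (y1 + s) - act (y1 + s) \<mu> \<in> S" using q \<open>\<mu> = q2\<close> by simp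
    then have "(u (y1 + s) - act (y1 + s) \<mu>) - (u y1 - act y1 \<mu>) \<in> S"
      using \<mu> S by (simp add: subsp_diff)
    then show ?thesis by (simp add: uadd act_simps)
  qed
  have "u w - act w \<mu> \<in> S" for w
  proof (cases "w \<in> S")
    case True
    then show ?thesis by (rule onS)
  next
    case False
    then obtain q where q: "u w - act w q \<in> S" using ev by blast
    show ?thesis
    \<comment> \<open>A vector independent of \<open>y1\<close> modulo \<open>S\<close> shares its
      eigenvalue; any other one is a multiple of \<open>y1\<close> up to an element of
      \<open>S\<close>.\<close>
    proof (cases "\<forall>\<alpha> \<beta>. act w \<alpha> + act y1 \<beta> \<in> S \<longrightarrow> \<alpha> = 0 \<and> \<beta> = 0")
      case True
      have "q = \<mu>" by (rule same[OF _ q \<mu>]) (use True in blast)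
      then show ?thesis using q by simp
    next
      case False
      then obtain \<alpha> \<beta> where ab: "act w \<alpha> + act y1 \<beta> \<in> S" "\<alpha> \<noteq> 0 \<or> \<beta> \<noteq> 0" by blast
      have "\<alpha> \<noteq> 0"
        using ab ind[of \<beta> 0] by auto
      define \<gamma> where "\<gamma> = \<beta> * inverse \<alpha>"
      define s where "s = act (act w \<alpha> + act y1 \<beta>) (inverse \<alpha>)"
      have sS: "s \<in> S" unfolding s_def using S ab(1) by (rule subsp_act)
      have w: "w = s - act y1 \<gamma>"
        using \<open>\<alpha> \<noteq> 0\<close> by (simp add: s_def \<gamma>_def act_simps)
      have "u w - act w \<mu> = (u s - act s \<mu>) - act (u y1 - act y1 \<mu>) \<gamma>"
      proof -
        have "u w + u (act y1 \<gamma>) = u s" using uadd[of w "act y1 \<gamma>"] w by simp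
        then have "u w = u s - act (u y1) \<gamma>" by (simp add: uact algebra_simps)
        then show ?thesis using Z_commute[OF \<mu>Z, of \<gamma>] by (simp add: w act_simps)
      qed
      then show ?thesis using onS[OF sS] \<mu> S by (simp add: subsp_diff subsp_act)
    qed
  qed
  with \<mu>Z show ?thesis by blast
qed

section \<open>Central scalars plus maps of rank at most one\<close>

definition near_scalar :: "('v \<Rightarrow> 'v) \<Rightarrow> bool" where
  "near_scalar u \<longleftrightarrow> (\<exists>\<mu>\<in>Z. \<exists>v. \<forall>x. \<exists>q. u x = act x \<mu> + act v q)"

lemma family_span_1: "family_span act 1 e = range (act (e 0))"
  by (auto simp: family_span_def intro: exI[of _ "\<lambda>_. _"])

lemma near_scalar_special:
  assumes u: "endomorphism act u" and n: "has_dim act UNIV n" "2 \<le> n" and ns: "near_scalar u"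
  shows "u = (\<lambda>x. 0) \<or> special_type_I scale act u \<or> special_type_II scale act u"
proof -
  have uadd: "u (x + y) = u x + u y" and uact: "u (act x q) = act (u x) q" for x y q
    using u by (auto simp: endomorphism_def)
  obtain c v where v: "\<And>x. \<exists>q. u x = act x (scale c 1) + act v q"
    using ns by (auto simp: near_scalar_def Z_def)
  define a where "a x = u x - act x (scale c 1)" for x
  have comm: "scale c 1 * q = q * scale c 1" for q
    by (simp add: Z_commute scale_one_Z)
  have a: "endomorphism act a"
    unfolding endomorphism_def a_def by (simp add: uadd uact act_simps comm)
  have ua: "u = (\<lambda>x. scalar_endo scale act c x + a x)"
    by (simp add: a_def scalar_endo_def)
  show ?thesis
  proof (cases "\<forall>x. a x = 0")
    case True
    then have us: "u = scalar_endo scale act c" by (simp add: ua)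
    show ?thesis
    proof (cases "c = 0")
      case True
      then show ?thesis by (simp add: us scalar_endo_def)
    next
      case False
      then show ?thesis using us by (auto simp: special_type_I_def)
    qed
  next
    case False
    then obtain x where x: "a x \<noteq> 0" by blast
    have av: "\<exists>q. a y = act v q" for y using v[of y] by (auto simp: a_def)
    obtain q where q: "a x = act v q" using av by blast
    have "q \<noteq> 0" using x q by auto
    have "\<exists>p. a y = act (a x) p" for y
    proof -
      obtain r where "a y = act v r" using av by blast
      then have "a y = act (a x) (inverse q * r)"
        using \<open>q \<noteq> 0\<close> by (simp add: q act_simps mult.assoc[symmetric])
      then show ?thesis ..
    qed
    moreover have "act (a x) p \<in> range a" for p
      using a by (auto simp: endomorphism_def intro: range_eqI[of _ _ "act x p"])
    ultimately have "range a = family_span act 1 (\<lambda>_. a x)"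
      unfolding family_span_1 by (auto simp: image_iff)
    moreover have "family_independent act 1 (\<lambda>_. a x)"
      using x by (simp add: family_independent_def act_eq_0_iff)
    ultimately have "has_rank act a 1"
      by (auto simp: has_rank_def has_dim_def is_basis_def)
    then show ?thesis using a ua n by (auto simp: special_type_II_def)
  qed
qed

text \<open>If every line is invariant, \<open>scalar_modulo_subspace\<close> with the zero subspace
  makes \<open>u\<close> a central scalar.\<close>

lemma scalar_or_moving:
  assumes b: "is_basis act UNIV n e" and n: "2 \<le> n" and u: "endomorphism act u"
  shows "near_scalar u \<or> (\<exists>x. \<forall>q. u x \<noteq> act x q)"
proof (cases "\<exists>x. \<forall>q. u x \<noteq> act x q")
  case False
  have "family_independent act 2 e"
    using b n family_independent_mono by (auto simp: is_basis_def)
  then have "\<exists>\<mu>\<in>Z. \<forall>y. u y - act y \<mu> \<in> {0}"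
    using False by (intro scalar_modulo_subspace[of _ _ "e 0" "e 1"])
      (auto simp: u subsp_def family_independent_2)
  then show ?thesis
    unfolding near_scalar_def by (metis act_zero_left add.right_neutral eq_iff_diff_eq_0 singletonD)
qed simp

lemma moving_independent:
  assumes x: "\<And>q. u x \<noteq> act x q" and u: "endomorphism act u" and 0: "act x \<alpha> + act (u x) \<beta> = 0"
  shows "\<alpha> = 0 \<and> \<beta> = 0"
proof -
  have "\<beta> = 0"
  proof (rule ccontr)
    assume "\<beta> \<noteq> 0"
    have "act (u x) \<beta> = act x (- \<alpha>)" using 0 by (simp add: act_simps eq_neg_iff_add_eq_0 add.commute)
    then have "act (act (u x) \<beta>) (inverse \<beta>) = act (act x (- \<alpha>)) (inverse \<beta>)" by simp
    then have "u x = act x (- \<alpha> * inverse \<beta>)" using \<open>\<beta> \<noteq> 0\<close> by (simp add: act_simps)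
    then show False using x by blast
  qed
  moreover have "x \<noteq> 0"
  proof
    assume "x = 0"
    then have "u x = act x 0" using u endomorphism_def[of act u] act_zero_right by metis
    then show False using x by blast
  qed
  ultimately show ?thesis using 0 by (simp add: act_eq_0_iff)
qed

definition plane :: "'v \<Rightarrow> 'v \<Rightarrow> 'v set" where
  "plane x y = {act x \<alpha> + act y \<beta> | \<alpha> \<beta>. True}"

lemma planeI: "act x \<alpha> + act y \<beta> \<in> plane x y"
  by (auto simp: plane_def)

lemma subsp_plane: "subsp (plane x y)"
  unfolding subsp_def
proof (intro conjI ballI allI)
  show "0 \<in> plane x y" using planeI[of x 0 y 0] by simp
next
  fix v w q assume "v \<in> plane x y" "w \<in> plane x y"
  then obtain a b c d where "v = act x a + act y b" "w = act x c + act y d" by (auto simp: plane_def)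
  then show "v + w \<in> plane x y"
    using planeI[of x "a + c" y "b + d"] by (simp add: act_add_right algebra_simps)
next
  fix v q assume "v \<in> plane x y"
  then obtain a b where "v = act x a + act y b" by (auto simp: plane_def)
  then show "act v q \<in> plane x y"
    using planeI[of x "a * q" y "b * q"] by (simp add: act_simps)
qed

lemma solve_right:
  assumes S: "subsp S" and 0: "act y \<gamma> + s = 0" and s: "s \<in> S" and \<gamma>: "\<gamma> \<noteq> 0"
  shows "y \<in> S"
proof -
  have "act y \<gamma> = - s" using 0 by (simp add: eq_neg_iff_add_eq_0)
  then have "act (act y \<gamma>) (inverse \<gamma>) = act (- s) (inverse \<gamma>)" by simp
  then have "y = act (- s) (inverse \<gamma>)" using \<gamma> by (simp add: act_simps)
  then show ?thesis using subsp_act[OF S subsp_minus[OF S s]] by simp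
qed

text \<open>Let \<open>S\<close> be spanned by \<open>x\<close> and \<open>u x\<close> for a vector
  \<open>x\<close> that is not an eigenvector. Dependence of \<open>x, u x, y, u y\<close> makes
  each \<open>y\<close> outside \<open>S\<close> an eigenvector modulo \<open>S\<close>, so
  \<open>u\<close> is a central scalar plus a map \<open>v\<close> into \<open>S\<close>. Using
  dependence again, now of \<open>y, u y, z, u z\<close> with \<open>v y\<close> nonzero, confines
  \<open>v\<close> to one line.\<close>

lemma not_bicyclic_near_scalar:
  assumes b: "is_basis act UNIV n e" and n: "4 \<le> n" and u: "endomorphism act u"
    and ng: "\<not> bicyclic UNIV u"
  shows "near_scalar u"
proof -
  have uadd: "u (x + y) = u x + u y" and uact: "u (act x q) = act (u x) q" for x y q
    using u by (auto simp: endomorphism_def)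
  have dep: "\<exists>\<alpha> \<beta> \<gamma> \<delta>. act x \<alpha> + act (u x) \<beta> + act y \<gamma> + act (u y) \<delta> = 0 \<and>
      \<not> (\<alpha> = 0 \<and> \<beta> = 0 \<and> \<gamma> = 0 \<and> \<delta> = 0)" for x y
    using ng unfolding bicyclic_def family_independent_4 by (simp add: eval_nat_numeral)
  show ?thesis
  proof (cases "near_scalar u")
    case False
    then obtain x where x: "\<And>q. u x \<noteq> act x q"
      using scalar_or_moving[OF b _ u] n by fastforce
    note xi = moving_independent[OF x u]
    define S where "S = plane x (u x)"
    have S: "subsp S" by (simp add: S_def subsp_plane)
    have "family_independent act 2 ((!) [x, u x])"
      unfolding family_independent_2 using xi by simp
    then obtain f where f: "is_basis act UNIV n f" and "\<forall>i<2. f i = [x, u x] ! i"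
      by (elim basis_extend_list[OF b]) auto
    then have f01: "f 0 = x" "f 1 = u x" by (auto simp: eval_nat_numeral All_less_Suc)
    have f4: "family_independent act 4 f"
      using f n family_independent_mono by (auto simp: is_basis_def)
    have f23: "\<alpha> = 0 \<and> \<beta> = 0" if fS: "act (f 2) \<alpha> + act (f 3) \<beta> \<in> S" for \<alpha> \<beta>
    proof -
      obtain c d where "act (f 2) \<alpha> + act (f 3) \<beta> = act (f 0) c + act (f 1) d"
        using fS unfolding S_def plane_def f01 by blast
      then have "act (f 0) (- c) + act (f 1) (- d) + act (f 2) \<alpha> + act (f 3) \<beta> = 0"
        by (simp add: act_minus_right algebra_simps)
      then show ?thesis using f4 unfolding family_independent_4 by blast
    qed
    have "\<exists>q. u y - act y q \<in> S" if y: "y \<notin> S" for y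
    proof -
      obtain \<alpha> \<beta> \<gamma> \<delta> where 0: "act x \<alpha> + act (u x) \<beta> + act y \<gamma> + act (u y) \<delta> = 0"
        and nz: "\<not> (\<alpha> = 0 \<and> \<beta> = 0 \<and> \<gamma> = 0 \<and> \<delta> = 0)" using dep by blast
      have pl: "act x \<alpha> + act (u x) \<beta> \<in> S" by (simp add: S_def planeI)
      have "\<delta> \<noteq> 0"
      proof
        assume "\<delta> = 0"
        then have "act y \<gamma> + (act x \<alpha> + act (u x) \<beta>) = 0" using 0 by (simp add: add_ac)
        then have "\<gamma> = 0" using solve_right[OF S _ pl] y by blast
        then show False using 0 nz \<open>\<delta> = 0\<close> xi by simp
      qed
      have "act (u y - act y (- \<gamma> * inverse \<delta>)) \<delta> + (act x \<alpha> + act (u x) \<beta>) = 0"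
        using 0 \<open>\<delta> \<noteq> 0\<close> by (simp add: act_simps mult.assoc algebra_simps)
      then show ?thesis using solve_right[OF S _ pl \<open>\<delta> \<noteq> 0\<close>] by blast
    qed
    then obtain \<mu> where \<mu>: "\<mu> \<in> Z" and \<mu>S: "\<And>y. u y - act y \<mu> \<in> S"
      using scalar_modulo_subspace[OF S u f23] by blast
    define v where "v y = u y - act y \<mu>" for y
    have uv: "u y = act y \<mu> + v y" for y by (simp add: v_def)
    have vadd: "v (y + z) = v y + v z" for y z by (simp add: v_def uadd act_simps)
    have vS: "v y \<in> S" for y by (simp add: v_def \<mu>S)
    \<comment> \<open>A map vanishing outside \<open>S\<close> vanishes on differences of outside
      vectors, hence everywhere, and \<open>u\<close> would be scalar.\<close>
    have "\<exists>y. y \<notin> S \<and> v y \<noteq> 0"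
    proof (rule ccontr)
      assume "\<not> ?thesis"
      then have v0: "v y = 0" if "y \<notin> S" for y using that by blast
      have "f 2 \<notin> S" using f23[of 1 0] by (auto simp: act_one)
      then have "y + f 2 \<notin> S" if "y \<in> S" for y using that subsp_diff[OF S, of "y + f 2" y] by auto
      then have "v y = 0" for y using v0[of y] v0[of "y + f 2"] v0[of "f 2"] \<open>f 2 \<notin> S\<close> vadd by auto
      then have "u y = act y \<mu> + act 0 0" for y by (simp add: uv)
      then show False using False \<mu> unfolding near_scalar_def by blast
    qed
    then obtain y where y: "y \<notin> S" and vy: "v y \<noteq> 0" by blast
    define T where "T = {s + act y q | s q. s \<in> S}"
    have T: "subsp T"
      unfolding subsp_def
    proof (intro conjI ballI allI)
      show "0 \<in> T" using subsp_0[OF S] by (auto simp: T_def intro!: exI[of _ 0])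
      show "a + b \<in> T" if ab: "a \<in> T" "b \<in> T" for a b
      proof -
        obtain s q s' q' where "a = s + act y q" "b = s' + act y q'" "s \<in> S" "s' \<in> S"
          using ab by (auto simp: T_def)
        then have "a + b = (s + s') + act y (q + q') \<and> s + s' \<in> S"
          using S by (simp add: subsp_add act_add_right algebra_simps)
        then show ?thesis unfolding T_def by blast
      qed
      show "act a p \<in> T" if a: "a \<in> T" for a p
      proof -
        obtain s q where "a = s + act y q" "s \<in> S" using a by (auto simp: T_def)
        then have "act a p = act s p + act y (q * p) \<and> act s p \<in> S"
          using S by (simp add: subsp_act act_simps)
        then show ?thesis unfolding T_def by blast
      qed
    qed
    have TI: "s + act y q \<in> T" if "s \<in> S" for s q using that by (auto simp: T_def)
    have multiple: "\<exists>q. v z = act (v y) q" if z: "z \<notin> T" for z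
    proof -
      obtain \<alpha> \<beta> \<gamma> \<delta> where 0: "act y \<alpha> + act (u y) \<beta> + act z \<gamma> + act (u z) \<delta> = 0"
        and nz: "\<not> (\<alpha> = 0 \<and> \<beta> = 0 \<and> \<gamma> = 0 \<and> \<delta> = 0)" using dep by blast
      \<comment> \<open>Writing \<open>u = \<mu> + v\<close> sorts the dependence by
        \<open>z\<close>, \<open>y\<close> and \<open>S\<close>: the first coefficient vanishes
        because \<open>z\<close> is outside \<open>T\<close>, the next because \<open>y\<close> is
        outside \<open>S\<close>, and a relation between \<open>v y\<close> and \<open>v z\<close>
        remains.\<close>
      have 1: "act z (\<gamma> + \<mu> * \<delta>) + ((act (v y) \<beta> + act (v z) \<delta>) + act y (\<alpha> + \<mu> * \<beta>)) = 0"
        using 0 by (simp add: uv act_simps algebra_simps)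
      have 2: "act (v y) \<beta> + act (v z) \<delta> \<in> S" using S vS by (simp add: subsp_add subsp_act)
      have 3: "\<gamma> + \<mu> * \<delta> = 0" using solve_right[OF T 1 TI[OF 2]] z by blast
      with 1 have "act y (\<alpha> + \<mu> * \<beta>) + (act (v y) \<beta> + act (v z) \<delta>) = 0" by (simp add: add_ac)
      with solve_right[OF S _ 2] y have 4: "\<alpha> + \<mu> * \<beta> = 0" by blast
      have 5: "act (v z) \<delta> + act (v y) \<beta> = 0" using 1 3 4 by (simp add: add_ac)
      have "\<delta> \<noteq> 0"
      proof
        assume "\<delta> = 0"
        then have "\<beta> = 0" using 5 vy by (simp add: act_eq_0_iff)
        then show False using \<open>\<delta> = 0\<close> 3 4 nz by simp
      qed
      have "act (v z) \<delta> = act (v y) (- \<beta>)" using 5 by (simp add: act_minus_right eq_neg_iff_add_eq_0)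
      then have "act (act (v z) \<delta>) (inverse \<delta>) = act (act (v y) (- \<beta>)) (inverse \<delta>)" by simp
      then have "v z = act (v y) (- \<beta> * inverse \<delta>)" using \<open>\<delta> \<noteq> 0\<close> by (simp add: act_simps)
      then show ?thesis ..
    qed
    have "family_independent act 3 ((!) [x, u x, y])"
      unfolding family_independent_3
    proof (intro allI impI)
      fix \<alpha> \<beta> \<gamma>
      assume "act ([x, u x, y] ! 0) \<alpha> + act ([x, u x, y] ! 1) \<beta> + act ([x, u x, y] ! 2) \<gamma> = 0"
      then have 0: "act y \<gamma> + (act x \<alpha> + act (u x) \<beta>) = 0" by (simp add: add_ac)
      then have "\<gamma> = 0" using solve_right[OF S 0] y by (auto simp: S_def planeI)
      then show "\<alpha> = 0 \<and> \<beta> = 0 \<and> \<gamma> = 0" using 0 xi by simp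
    qed
    then obtain g where g: "is_basis act UNIV n g" and "\<forall>i<3. g i = [x, u x, y] ! i"
      by (elim basis_extend_list[OF b]) auto
    then have g012: "g 0 = x" "g 1 = u x" "g 2 = y" unfolding all_less_3 by simp_all
    have g4: "family_independent act 4 g"
      using g n family_independent_mono by (auto simp: is_basis_def)
    have g3: "g 3 \<notin> T"
    proof
      assume "g 3 \<in> T"
      then obtain \<alpha> \<beta> \<gamma> where "g 3 = act (g 0) \<alpha> + act (g 1) \<beta> + act (g 2) \<gamma>"
        unfolding T_def S_def plane_def g012 by auto
      then have "act (g 0) \<alpha> + act (g 1) \<beta> + act (g 2) \<gamma> + act (g 3) (- 1) = 0"
        by (simp add: act_minus_right act_one)
      then have "- 1 = (0 :: 'q)" using g4 unfolding family_independent_4 by blast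
      then show False by simp
    qed
    have "\<exists>q. v w = act (v y) q" for w
    proof (cases "w \<in> T")
      case True
      \<comment> \<open>\<open>T\<close> has dimension 3, so a fourth basis vector lies outside and
        each \<open>w\<close> in \<open>T\<close> is a difference of outside vectors.\<close>
      have "w + g 3 \<notin> T" using True g3 subsp_diff[OF T, of "w + g 3" w] by auto
      then obtain p q where "v (w + g 3) = act (v y) p" "v (g 3) = act (v y) q"
        using multiple g3 by blast
      then have "v w = act (v y) (p - q)" using vadd[of w "g 3"] by (simp add: act_diff_right algebra_simps)
      then show ?thesis ..
    qed (rule multiple)
    then show ?thesis unfolding near_scalar_def using \<mu> uv by metis
  qed simp
qed

section \<open>Dimension 3 without a cyclic triple\<close>

definition isotypic :: "('v \<Rightarrow> 'v) \<Rightarrow> bool" where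
  "isotypic u \<longleftrightarrow> (\<exists>f \<delta>. is_basis act UNIV 3 f \<and> (\<forall>i<3. u (f i) = act (f i) \<delta>))"

text \<open>A nonzero coordinate \<open>c i\<close> of an eigenvector satisfies
  \<open>\<delta> * c i = c i * q\<close>, so all eigenvalues are conjugate to
  \<open>\<delta>\<close>; rescaling \<open>f 0\<close> realises every conjugate.\<close>

lemma isotypic_special_type_III:
  assumes u: "endomorphism act u" and iso: "isotypic u" and nz: "u \<noteq> (\<lambda>x. 0)"
  shows "special_type_III act u"
proof -
  obtain f \<delta> where f: "is_basis act UNIV 3 f" and uf: "\<And>i. i < 3 \<Longrightarrow> u (f i) = act (f i) \<delta>"
    using iso by (auto simp: isotypic_def)
  have f0: "f i \<noteq> 0" if i: "i < 3" for i
  proof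
    assume "f i = 0"
    then have "lc 3 f (\<lambda>j. if j = i then 1 else 0) = 0" using i by (simp add: lc_single)
    from is_basisD(4)[OF f this i] show False by simp
  qed
  have eig: "is_eigenvector act u \<delta> (f i)" if "i < 3" for i
    using that f0 uf by (simp add: is_eigenvector_def)
  have "eigenvalues act u = conjugacy_class \<delta>"
  proof (intro set_eqI iffI)
    fix q assume "q \<in> eigenvalues act u"
    then obtain w where w: "w \<noteq> 0" "u w = act w q" by (auto simp: eigenvalues_def is_eigenvector_def)
    obtain c where c: "w = lc 3 f c" using basis_coordsE[OF f UNIV_I] .
    obtain i where i: "i < 3" "c i \<noteq> 0"
      using w(1) c unfolding lc_def by (metis (mono_tags, lifting) act_zero_right lessThan_iff sum.neutral)
    have "u w = lc 3 (u \<circ> f) c"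
      unfolding c using u by (intro lin_on_lc[OF _ subsp_UNIV]) (auto simp: lin_on_UNIV)
    also have "\<dots> = lc 3 f (\<lambda>i. \<delta> * c i)"
      unfolding lc_def by (intro sum.cong) (auto simp: uf act_mult)
    finally have "lc 3 f (\<lambda>i. \<delta> * c i) = lc 3 f (\<lambda>i. c i * q)"
      using w(2) by (simp add: c lc_act)
    from lc_unique[OF f this i(1)] have "inverse (c i) * \<delta> * c i = q"
      using i(2) by (simp add: mult.assoc) (simp flip: mult.assoc add: i(2))
    then show "q \<in> conjugacy_class \<delta>"
      unfolding conjugacy_class_def using i(2) by (auto intro!: exI[of _ "inverse (c i)"])
  next
    fix q assume "q \<in> conjugacy_class \<delta>"
    then obtain p where p: "p \<noteq> 0" "q = p * \<delta> * inverse p" by (auto simp: conjugacy_class_def)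
    have "u (act (f 0) (inverse p)) = act (act (f 0) (inverse p)) q"
      using u p uf[of 0] by (simp add: endomorphism_def act_simps) (simp flip: mult.assoc add: p)
    moreover have "act (f 0) (inverse p) \<noteq> 0" using p f0[of 0] by (simp add: act_eq_0_iff)
    ultimately show "q \<in> eigenvalues act u" by (auto simp: eigenvalues_def is_eigenvector_def)
  qed
  then have "unispectral act u" by (auto simp: unispectral_def)
  moreover have "diagonalisable act u" using f eig unfolding diagonalisable_def by blast
  moreover have "has_dim act UNIV 3" using f by (auto simp: has_dim_def)
  ultimately show ?thesis using nz by (simp add: special_type_III_def)
qed

lemma basis_3I:
  assumes b: "is_basis act UNIV 3 e"
    and ind: "\<And>\<alpha> \<beta> \<gamma>. act x \<alpha> + act y \<beta> + act z \<gamma> = 0 \<Longrightarrow> \<alpha> = 0 \<and> \<beta> = 0 \<and> \<gamma> = 0"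
  shows "is_basis act UNIV 3 ((!) [x, y, z])"
proof (rule independent_imp_basis[OF b])
  show "family_independent act 3 ((!) [x, y, z])"
    unfolding family_independent_3 using ind by simp
qed simp

lemma basis_3D:
  assumes b: "is_basis act UNIV 3 ((!) [x, y, z])"
  shows "act x \<alpha> + act y \<beta> + act z \<gamma> = 0 \<Longrightarrow> \<alpha> = 0 \<and> \<beta> = 0 \<and> \<gamma> = 0"
    and "\<exists>\<alpha> \<beta> \<gamma>. w = act x \<alpha> + act y \<beta> + act z \<gamma>"
proof -
  have "family_independent act 3 ((!) [x, y, z])" using b by (simp add: is_basis_def)
  then show "\<alpha> = 0 \<and> \<beta> = 0 \<and> \<gamma> = 0" if "act x \<alpha> + act y \<beta> + act z \<gamma> = 0"
    using that unfolding family_independent_3 by simp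
  obtain c where "w = lc 3 ((!) [x, y, z]) c" using basis_coordsE[OF b UNIV_I] .
  then show "\<exists>\<alpha> \<beta> \<gamma>. w = act x \<alpha> + act y \<beta> + act z \<gamma>" unfolding lc_3 by auto
qed

text \<open>For a non-central eigenvalue \<open>\<delta>\<close>, the entries above the diagonal are commutators with
  \<open>\<delta>\<close>, so that they can be removed by a unipotent change of basis.\<close>

lemma unipotent_isotypic:
  assumes u: "endomorphism act u" and b: "is_basis act UNIV 3 ((!) [p, x, y])" and \<delta>: "\<delta> \<notin> Z"
    and up: "u p = act p \<delta>" and ux: "u x = act p \<epsilon> + act x \<delta>"
    and uy: "u y = act p \<sigma> + act x \<tau> + act y \<delta>"
    and E: "\<And>r. \<tau> + (\<delta> * r - r * \<delta>) \<noteq> 0 \<Longrightarrow>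
        \<delta> * (\<sigma> + \<epsilon> * r) + \<epsilon> * (\<tau> + (\<delta> * r - r * \<delta>)) = (\<sigma> + \<epsilon> * r) * cj \<delta> \<and>
        \<delta> * (\<tau> + (\<delta> * r - r * \<delta>)) = (\<tau> + (\<delta> * r - r * \<delta>)) * cj \<delta>"
  shows "isotypic u"
proof -
  have uadd: "u (x + y) = u x + u y" and uact: "u (act x q) = act (u x) q" for x y q
    using u by (auto simp: endomorphism_def)
  have udiff: "u (x - y) = u x - u y" for x y
    using uadd[of "x - y" y] by simp
  obtain r1 where r1: "\<delta> * r1 \<noteq> r1 * \<delta>" using \<delta> Z_iff by blast
  have "\<exists>r. \<tau> + (\<delta> * r - r * \<delta>) \<noteq> 0"
  proof (cases "\<tau> = 0")
    case True
    then show ?thesis using r1 by (intro exI[of _ r1]) simp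
  next
    case False
    then show ?thesis by (intro exI[of _ 0]) simp
  qed
  then obtain r where r: "\<tau> + (\<delta> * r - r * \<delta>) \<noteq> 0" by blast
  \<comment> \<open>Passing from \<open>r\<close> to \<open>r + 1\<close> keeps the commutator, so
    subtracting the two instances of \<open>E\<close> isolates \<open>\<epsilon>\<close>.\<close>
  have r': "\<delta> * (r + 1) - (r + 1) * \<delta> = \<delta> * r - r * \<delta>" by (simp add: algebra_simps)
  have \<tau>: "\<delta> * \<tau> = \<tau> * cj \<delta>"
    using E[OF r] commutator_cj'[of \<delta> r] by (simp add: distrib_left distrib_right)
  define g where "g = \<tau> + (\<delta> * r - r * \<delta>)"
  have E1: "\<delta> * (\<sigma> + \<epsilon> * r) + \<epsilon> * g = (\<sigma> + \<epsilon> * r) * cj \<delta>"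
    using E[OF r] by (simp add: g_def)
  have E2: "\<delta> * (\<sigma> + \<epsilon> * (r + 1)) + \<epsilon> * g = (\<sigma> + \<epsilon> * (r + 1)) * cj \<delta>"
    using E[of "r + 1"] r unfolding r' g_def by blast
  have \<epsilon>: "\<delta> * \<epsilon> = \<epsilon> * cj \<delta>"
  proof -
    have "\<delta> * (\<sigma> + \<epsilon> * (r + 1)) + \<epsilon> * g - (\<delta> * (\<sigma> + \<epsilon> * r) + \<epsilon> * g) = \<delta> * \<epsilon>"
      by (simp add: algebra_simps)
    moreover have "(\<sigma> + \<epsilon> * (r + 1)) * cj \<delta> - (\<sigma> + \<epsilon> * r) * cj \<delta> = \<epsilon> * cj \<delta>"
      by (simp add: algebra_simps)
    ultimately show ?thesis using E1 E2 by simp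
  qed
  \<comment> \<open>By the relation for \<open>\<epsilon>\<close>, the terms of \<open>E1\<close>
    containing \<open>r\<close> add up to \<open>\<epsilon>\<close> times a commutator with the
    central trace of \<open>\<delta>\<close>, hence cancel.\<close>
  have \<sigma>: "\<delta> * \<sigma> + \<epsilon> * \<tau> = \<sigma> * cj \<delta>"
  proof -
    have "\<delta> * (\<epsilon> * r) + \<epsilon> * (\<delta> * r - r * \<delta>) - \<epsilon> * r * cj \<delta> = (\<delta> * \<epsilon>) * r + \<epsilon> * (\<delta> * r) - \<epsilon> * (r * (\<delta> + cj \<delta>))"
      by (simp add: algebra_simps)
    also have "\<dots> = \<epsilon> * ((\<delta> + cj \<delta>) * r) - \<epsilon> * (r * (\<delta> + cj \<delta>))"
      unfolding \<epsilon> by (simp add: algebra_simps)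
    also have "\<dots> = 0"
      using Z_commute[OF tq_Z[of \<delta>], of r] by (simp add: cj_def)
    finally show ?thesis using E1 by (simp add: g_def algebra_simps)
  qed
  obtain h1 where h1: "\<epsilon> = \<delta> * h1 - h1 * \<delta>" using cj_commutes_imp_commutator[OF \<delta> \<epsilon>] by blast
  obtain h2 where h2: "\<tau> = \<delta> * h2 - h2 * \<delta>" using cj_commutes_imp_commutator[OF \<delta> \<tau>] by blast
  \<comment> \<open>\<open>\<sigma> + h1 * \<tau>\<close> is the coefficient of \<open>p\<close> in
    \<open>u y\<close> once \<open>x\<close> has been replaced by \<open>x - p h1\<close>.\<close>
  have "\<delta> * (\<sigma> + h1 * \<tau>) = (\<sigma> + h1 * \<tau>) * cj \<delta>"
  proof -
    have "\<delta> * (\<sigma> + h1 * \<tau>) = \<sigma> * cj \<delta> - \<epsilon> * \<tau> + \<delta> * (h1 * \<tau>)"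
      using \<sigma> by (simp add: distrib_left eq_diff_eq)
    also have "\<dots> = \<sigma> * cj \<delta> + h1 * (\<delta> * \<tau>)"
      unfolding h1 by (simp add: algebra_simps)
    finally show ?thesis unfolding \<tau> by (simp add: algebra_simps)
  qed
  then obtain h3 where h3: "\<sigma> + h1 * \<tau> = \<delta> * h3 - h3 * \<delta>"
    using cj_commutes_imp_commutator[OF \<delta>] by blast
  then have \<sigma>': "\<sigma> = \<delta> * h3 - h3 * \<delta> - h1 * \<tau>" by (simp add: eq_diff_eq)
  define x' y' where "x' = x - act p h1" and "y' = y - act x' h2 - act p h3"
  have ux': "u x' = act x' \<delta>"
    by (simp add: x'_def udiff uact ux up h1 act_simps)
  have uy': "u y' = act y' \<delta>"
    unfolding y'_def udiff uact ux' up uy \<sigma>' h2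
    by (simp add: x'_def act_simps algebra_simps)
  have "is_basis act UNIV 3 ((!) [p, x', y'])"
  proof (rule basis_3I[OF b])
    fix \<alpha> \<beta> \<gamma> assume "act p \<alpha> + act x' \<beta> + act y' \<gamma> = 0"
    then have "act p (\<alpha> - h1 * \<beta> + h1 * h2 * \<gamma> - h3 * \<gamma>) + act x (\<beta> - h2 * \<gamma>) + act y \<gamma> = 0"
      by (simp add: x'_def y'_def act_simps algebra_simps)
    from basis_3D(1)[OF b this] show "\<alpha> = 0 \<and> \<beta> = 0 \<and> \<gamma> = 0" by auto
  qed
  moreover have "\<forall>i<3. u ([p, x', y'] ! i) = act ([p, x', y'] ! i) \<delta>"
    unfolding all_less_3 using up ux' uy' by simp
  ultimately show ?thesis unfolding isotypic_def by blast
qed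

text \<open>The vector in \<open>ev\<close> is \<open>u w - w \<delta>\<close> for
  \<open>w = y + p r + x s\<close>. If \<open>\<delta>\<close> is central, this family of
  eigenvectors forces \<open>u - \<delta>\<close> to have rank at most one. Otherwise
  \<open>\<eta>\<close> turns out conjugate to \<open>\<delta>\<close>, and rescaling
  \<open>x\<close> leads to \<open>unipotent_isotypic\<close>.\<close>

lemma triangular_case:
  assumes u: "endomorphism act u" and b: "is_basis act UNIV 3 ((!) [p, x, y])"
    and up: "u p = act p \<delta>" and ux: "u x = act p \<epsilon> + act x \<eta>"
    and uy: "u y = act p \<sigma> + act x \<tau> + act y \<delta>"
    and ev: "\<And>r s. \<exists>q. u (act p (\<sigma> + \<epsilon> * s + (\<delta> * r - r * \<delta>)) + act x (\<tau> + \<eta> * s - s * \<delta>)) =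
        act (act p (\<sigma> + \<epsilon> * s + (\<delta> * r - r * \<delta>)) + act x (\<tau> + \<eta> * s - s * \<delta>)) q"
  shows "near_scalar u \<or> isotypic u"
proof -
  have uadd: "u (x + y) = u x + u y" and uact: "u (act x q) = act (u x) q" for x y q
    using u by (auto simp: endomorphism_def)
  have E: "\<exists>q. \<delta> * (\<sigma> + \<epsilon> * s + (\<delta> * r - r * \<delta>)) + \<epsilon> * (\<tau> + \<eta> * s - s * \<delta>)
        = (\<sigma> + \<epsilon> * s + (\<delta> * r - r * \<delta>)) * q \<and> \<eta> * (\<tau> + \<eta> * s - s * \<delta>) = (\<tau> + \<eta> * s - s * \<delta>) * q" for r s
  proof -
    define g1 g2 where "g1 = \<sigma> + \<epsilon> * s + (\<delta> * r - r * \<delta>)" and "g2 = \<tau> + \<eta> * s - s * \<delta>"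
    obtain q where q: "u (act p g1 + act x g2) = act (act p g1 + act x g2) q"
      using ev[of s r] unfolding g1_def g2_def by blast
    have "act p (\<delta> * g1 + \<epsilon> * g2 - g1 * q) + act x (\<eta> * g2 - g2 * q) + act y 0
        = u (act p g1 + act x g2) - act (act p g1 + act x g2) q"
      by (simp add: uadd uact up ux act_simps algebra_simps)
    then have "\<delta> * g1 + \<epsilon> * g2 - g1 * q = 0 \<and> \<eta> * g2 - g2 * q = 0"
      using basis_3D(1)[OF b] q by (metis eq_iff_diff_eq_0)
    then show ?thesis unfolding g1_def[symmetric] g2_def[symmetric] by auto
  qed
  show ?thesis
  proof (cases "\<delta> \<in> Z")
    case True
    define \<eta>' where "\<eta>' = \<eta> - \<delta>"
    have comm: "r * \<delta> = \<delta> * r" for r using Z_commute[OF True, of r] by simp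
    have E': "\<exists>q. \<epsilon> * (\<tau> + \<eta>' * s) = (\<sigma> + \<epsilon> * s) * q \<and> \<eta>' * (\<tau> + \<eta>' * s) = (\<tau> + \<eta>' * s) * q" for s
    proof -
      obtain q where q: "\<delta> * (\<sigma> + \<epsilon> * s + (\<delta> * 0 - 0 * \<delta>)) + \<epsilon> * (\<tau> + \<eta> * s - s * \<delta>)
        = (\<sigma> + \<epsilon> * s + (\<delta> * 0 - 0 * \<delta>)) * q" "\<eta> * (\<tau> + \<eta> * s - s * \<delta>) = (\<tau> + \<eta> * s - s * \<delta>) * q"
        using E[of s 0] by blast
      have g: "\<tau> + \<eta> * s - s * \<delta> = \<tau> + \<eta>' * s" by (simp add: \<eta>'_def comm algebra_simps)
      have "\<epsilon> * (\<tau> + \<eta>' * s) = (\<sigma> + \<epsilon> * s) * (q - \<delta>)"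
        using q(1) unfolding g by (simp add: right_diff_distrib comm[of "\<sigma> + \<epsilon> * s"] eq_diff_eq add.commute)
      moreover have "\<eta>' * (\<tau> + \<eta>' * s) = (\<tau> + \<eta>' * s) * (q - \<delta>)"
        using q(2) unfolding g right_diff_distrib[of "\<tau> + \<eta>' * s"] comm[of "\<tau> + \<eta>' * s"]
        by (simp add: \<eta>'_def left_diff_distrib)
      ultimately show ?thesis by blast
    qed
    have form: "u (act p \<alpha> + act x \<beta> + act y \<gamma>) = act (act p \<alpha> + act x \<beta> + act y \<gamma>) \<delta>
        + (act (act p \<epsilon> + act x \<eta>') \<beta> + act (act p \<sigma> + act x \<tau>) \<gamma>)" for \<alpha> \<beta> \<gamma>
      by (simp add: uadd uact up ux uy \<eta>'_def comm act_simps algebra_simps)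
    \<comment> \<open>These are the images of \<open>x\<close> and \<open>y\<close> under
      \<open>u - \<delta>\<close>, which kills \<open>p\<close>; they must lie on one line.\<close>
    have "\<exists>v k l. act p \<epsilon> + act x \<eta>' = act v k \<and> act p \<sigma> + act x \<tau> = act v l"
    proof (cases "\<eta>' = 0")
      case False
      \<comment> \<open>With this \<open>s\<close> the second equation of \<open>E'\<close> reads
        \<open>\<eta>' = q\<close>, so the first one determines \<open>\<sigma>\<close>.\<close>
      define s where "s = inverse \<eta>' * (1 - \<tau>)"
      have "\<tau> + \<eta>' * s = 1" using False by (simp add: s_def mult.assoc[symmetric])
      then have "\<epsilon> = (\<sigma> + \<epsilon> * s) * \<eta>'" using E'[of s] by auto
      then have "\<epsilon> * inverse \<eta>' = \<sigma> + \<epsilon> * s" using False by (metis mult.assoc mult_1_right right_inverse)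
      then have "\<sigma> = \<epsilon> * (inverse \<eta>' * \<tau>)" by (simp add: s_def algebra_simps)
      moreover have "\<tau> = \<eta>' * (inverse \<eta>' * \<tau>)" using False by (simp flip: mult.assoc)
      ultimately have "act p \<sigma> + act x \<tau> = act (act p \<epsilon> + act x \<eta>') (inverse \<eta>' * \<tau>)"
        by (simp add: act_add_left flip: act_mult)
      then show ?thesis using act_one by metis
    next
      case True
      show ?thesis
      proof (cases "\<tau> = 0")
        case \<tau>: True
        then show ?thesis using \<open>\<eta>' = 0\<close> by (intro exI[of _ p] exI[of _ \<epsilon>] exI[of _ \<sigma>]) simp
      next
        case False
        then have "\<epsilon> = 0" using E'[of 0] True by auto
        then show ?thesis
          using True act_one by (intro exI[of _ "act p \<sigma> + act x \<tau>"] exI[of _ 0] exI[of _ 1]) simp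
      qed
    qed
    then obtain v k l where v: "act p \<epsilon> + act x \<eta>' = act v k" "act p \<sigma> + act x \<tau> = act v l" by blast
    have "\<exists>q. u w = act w \<delta> + act v q" for w
    proof -
      obtain \<alpha> \<beta> \<gamma> where w: "w = act p \<alpha> + act x \<beta> + act y \<gamma>" using basis_3D(2)[OF b] by blast
      have "u w = act w \<delta> + act v (k * \<beta> + l * \<gamma>)"
        unfolding w form v by (simp add: act_simps)
      then show ?thesis by blast
    qed
    then show ?thesis unfolding near_scalar_def using True by blast
  next
    case False
    \<comment> \<open>For nonzero \<open>g\<close> the equation \<open>\<eta> * g = g * q\<close>
      fixes \<open>q\<close>, independently of \<open>r\<close>. Varying \<open>r\<close> adds a
      commutator with \<open>\<delta>\<close> to the other coordinate, and this commutator forces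
      \<open>q = cj \<delta>\<close>.\<close>
    have key: "\<delta> * (\<sigma> + \<epsilon> * s) + \<epsilon> * (\<tau> + \<eta> * s - s * \<delta>) = (\<sigma> + \<epsilon> * s) * cj \<delta> \<and>
        \<eta> * (\<tau> + \<eta> * s - s * \<delta>) = (\<tau> + \<eta> * s - s * \<delta>) * cj \<delta>" if g0: "\<tau> + \<eta> * s - s * \<delta> \<noteq> 0" for s
    proof -
      define G g where "G = \<sigma> + \<epsilon> * s" and "g = \<tau> + \<eta> * s - s * \<delta>"
      obtain r where r: "\<delta> * r - r * \<delta> \<noteq> 0" using False Z_iff by fastforce
      obtain q where q: "\<delta> * G + \<epsilon> * g = G * q" "\<eta> * g = g * q"
        using E[of s 0] by (auto simp: G_def g_def)
      obtain q' where q': "\<delta> * (G + (\<delta> * r - r * \<delta>)) + \<epsilon> * g = (G + (\<delta> * r - r * \<delta>)) * q'" "\<eta> * g = g * q'"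
        using E[of s r] unfolding G_def g_def by blast
      have "q' = q" using q(2) q'(2) g0 by (simp add: g_def)
      have "\<delta> * (\<delta> * r - r * \<delta>) = (\<delta> * (G + (\<delta> * r - r * \<delta>)) + \<epsilon> * g) - (\<delta> * G + \<epsilon> * g)"
        by (simp add: distrib_left[of \<delta> G])
      also have "\<dots> = (\<delta> * r - r * \<delta>) * q"
        unfolding q(1) q'(1) \<open>q' = q\<close> by (simp add: distrib_right[of G])
      finally have "\<delta> * (\<delta> * r - r * \<delta>) = (\<delta> * r - r * \<delta>) * q" .
      then have "q = cj \<delta>" using commutator_cj'[of \<delta> r] r by simp
      then show ?thesis using q by (simp add: G_def g_def)
    qed
    have "\<exists>s. \<tau> + \<eta> * s - s * \<delta> \<noteq> 0"
    proof (rule ccontr)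
      assume "\<not> ?thesis"
      then have 0: "\<tau> + \<eta> * s - s * \<delta> = 0" for s by blast
      have "\<tau> = 0" using 0[of 0] by simp
      then have "\<eta> = \<delta>" using 0[of 1] by simp
      then have "\<delta> * s = s * \<delta>" for s using 0[of s] \<open>\<tau> = 0\<close> by simp
      then show False using False by (simp add: Z_iff)
    qed
    then obtain s where s: "\<tau> + \<eta> * s - s * \<delta> \<noteq> 0" by blast
    define g where "g = \<tau> + \<eta> * s - s * \<delta>"
    have g0: "g \<noteq> 0" and gc: "\<eta> * g = g * cj \<delta>" using s key[OF s] by (auto simp: g_def)
    obtain r where r: "\<delta> * r - r * \<delta> \<noteq> 0" using False Z_iff by fastforce
    define c where "c = \<delta> * r - r * \<delta>"
    have cc: "\<delta> * c = c * cj \<delta>" unfolding c_def by (rule commutator_cj')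
    have c0: "c \<noteq> 0" using r by (simp add: c_def)
    \<comment> \<open>\<open>g\<close> intertwines \<open>\<eta>\<close> with
      \<open>cj \<delta>\<close>, and \<open>c\<close> intertwines \<open>\<delta>\<close> with
      \<open>cj \<delta>\<close>; so \<open>m\<close> intertwines \<open>\<eta>\<close> with
      \<open>\<delta>\<close>, and \<open>x m\<close> has diagonal entry
      \<open>\<delta>\<close>.\<close>
    define m where "m = g * inverse c"
    have m0: "m \<noteq> 0" using g0 c0 by (simp add: m_def)
    have "inverse c * \<delta> = inverse c * (\<delta> * c) * inverse c" using c0 by (simp add: mult.assoc)
    also have "\<dots> = inverse c * (c * cj \<delta>) * inverse c" by (simp only: cc)
    also have "\<dots> = cj \<delta> * inverse c" using c0 by (simp flip: mult.assoc)
    finally have "inverse c * \<delta> = cj \<delta> * inverse c" .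
    then have \<eta>m: "\<eta> * m = m * \<delta>"
      using gc by (simp add: m_def mult.assoc) (simp flip: mult.assoc)
    have \<eta>: "\<eta> = m * \<delta> * inverse m" using \<eta>m m0 by (metis mult.assoc mult_1_right right_inverse)
    define x' \<tau>' where "x' = act x m" and "\<tau>' = inverse m * \<tau>"
    have x: "x = act x' (inverse m)" using m0 by (simp add: x'_def act_simps)
    have "isotypic u"
    proof (rule unipotent_isotypic[OF u _ False up])
      show "is_basis act UNIV 3 ((!) [p, x', y])"
      proof (rule basis_3I[OF b])
        fix \<alpha> \<beta> \<gamma> assume "act p \<alpha> + act x' \<beta> + act y \<gamma> = 0"
        then have "act p \<alpha> + act x (m * \<beta>) + act y \<gamma> = 0" by (simp add: x'_def act_simps)
        from basis_3D(1)[OF b this] show "\<alpha> = 0 \<and> \<beta> = 0 \<and> \<gamma> = 0" using m0 by simp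
      qed
      show "u x' = act p (\<epsilon> * m) + act x' \<delta>"
        by (simp add: x'_def uact ux act_simps \<eta>m)
      show "u y = act p \<sigma> + act x' \<tau>' + act y \<delta>"
        using m0 by (simp add: uy x'_def \<tau>'_def act_simps) (simp flip: mult.assoc)
      show "\<delta> * (\<sigma> + \<epsilon> * m * r) + \<epsilon> * m * (\<tau>' + (\<delta> * r - r * \<delta>)) = (\<sigma> + \<epsilon> * m * r) * cj \<delta> \<and>
          \<delta> * (\<tau>' + (\<delta> * r - r * \<delta>)) = (\<tau>' + (\<delta> * r - r * \<delta>)) * cj \<delta>"
        if nz: "\<tau>' + (\<delta> * r - r * \<delta>) \<noteq> 0" for r
      proof -
        let ?g = "\<tau>' + (\<delta> * r - r * \<delta>)"
        have g: "\<tau> + \<eta> * (m * r) - m * r * \<delta> = m * ?g"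
        proof -
          have "\<eta> * (m * r) = m * (\<delta> * r)" by (metis \<eta>m mult.assoc)
          moreover have "m * \<tau>' = \<tau>" using m0 by (simp add: \<tau>'_def flip: mult.assoc)
          ultimately show ?thesis by (simp add: algebra_simps)
        qed
        then have "\<tau> + \<eta> * (m * r) - m * r * \<delta> \<noteq> 0" using nz m0 by simp
        from key[OF this] have 1: "\<delta> * (\<sigma> + \<epsilon> * (m * r)) + \<epsilon> * (m * ?g) = (\<sigma> + \<epsilon> * (m * r)) * cj \<delta>"
          and 2: "\<eta> * (m * ?g) = m * ?g * cj \<delta>" unfolding g by auto
        from 2 have "m * (\<delta> * ?g) = m * (?g * cj \<delta>)" by (metis \<eta>m mult.assoc)
        then have "\<delta> * ?g = ?g * cj \<delta>" using m0 by simp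
        with 1 show ?thesis by (simp add: mult.assoc)
      qed
    qed
    then show ?thesis ..
  qed
qed

text \<open>For \<open>x\<close> not an eigenvector, the plane of \<open>x\<close> and
  \<open>u x\<close> is invariant, and \<open>u\<close> acts as \<open>\<delta>\<close> modulo it.
  An eigenvector \<open>p\<close> of the plane with this same \<open>\<delta>\<close> brings
  \<open>u\<close> into the form of \<open>triangular_case\<close>.\<close>

lemma not_cyclic3_special:
  assumes b: "is_basis act UNIV 3 e" and u: "endomorphism act u" and nc: "\<not> cyclic3 UNIV u"
  shows "near_scalar u \<or> isotypic u"
proof (cases "near_scalar u")
  case False
  have uadd: "u (x + y) = u x + u y" and uact: "u (act x q) = act (u x) q" for x y q
    using u by (auto simp: endomorphism_def)
  have dep: "\<exists>\<alpha> \<beta> \<gamma>. act w \<alpha> + act (u w) \<beta> + act (u (u w)) \<gamma> = 0 \<and> \<not> (\<alpha> = 0 \<and> \<beta> = 0 \<and> \<gamma> = 0)" for w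
    using nc unfolding cyclic3_def family_independent_3 by simp
  obtain x where x: "\<And>q. u x \<noteq> act x q"
    using False scalar_or_moving[OF b _ u] by fastforce
  note xi = moving_independent[OF x u]
  define z where "z = u x"
  have "family_independent act 2 ((!) [x, z])"
    unfolding family_independent_2 z_def using xi by simp
  then obtain f where f: "is_basis act UNIV 3 f" and "\<forall>i<2. f i = [x, z] ! i"
    by (elim basis_extend_list[OF b]) auto
  then have f01: "f 0 = x" "f 1 = z" by (auto simp: eval_nat_numeral All_less_Suc)
  define y where "y = f 2"
  have "\<forall>i<3. f i = [x, z, y] ! i" unfolding all_less_3 f01 y_def by simp
  then have g: "is_basis act UNIV 3 ((!) [x, z, y])" using is_basis_cong[OF f] by blast
  note gi = basis_3D(1)[OF g]
  have "\<exists>a b. u z = act x a + act z b"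
  proof -
    obtain \<alpha> \<beta> \<gamma> where 0: "act x \<alpha> + act z \<beta> + act (u z) \<gamma> = 0" and nz: "\<not> (\<alpha> = 0 \<and> \<beta> = 0 \<and> \<gamma> = 0)"
      using dep[of x] unfolding z_def by blast
    have "\<gamma> \<noteq> 0"
    proof
      assume "\<gamma> = 0"
      then show False using 0 xi nz unfolding z_def by simp
    qed
    then have "u z \<in> plane x z"
      using 0 by (intro solve_right[OF subsp_plane _ planeI]) (simp add: add.commute)
    then show ?thesis by (auto simp: plane_def)
  qed
  then obtain a b where uz: "u z = act x a + act z b" by blast
  obtain s1 s2 \<delta> where uy: "u y = act x s1 + act z s2 + act y \<delta>" using basis_3D(2)[OF g] by blast
  text \<open>For \<open>w = y + x \<alpha> + z \<beta>\<close> the vector \<open>u w - w \<delta>\<close> lies in the invariant plane of \<open>x\<close>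
    and \<open>z\<close>; if it were not an eigenvector there, \<open>w\<close> would be cyclic.\<close>
  have ev: "\<exists>q. u (act x (s1 + a * \<beta> - \<alpha> * \<delta>) + act z (s2 + \<alpha> + b * \<beta> - \<beta> * \<delta>)) =
      act (act x (s1 + a * \<beta> - \<alpha> * \<delta>) + act z (s2 + \<alpha> + b * \<beta> - \<beta> * \<delta>)) q" for \<alpha> \<beta>
  proof -
    define g1 g2 where "g1 = s1 + a * \<beta> - \<alpha> * \<delta>" and "g2 = s2 + \<alpha> + b * \<beta> - \<beta> * \<delta>"
    define v w where "v = act x g1 + act z g2" and "w = y + act x \<alpha> + act z \<beta>"
    have uw: "u w = act w \<delta> + v"
      by (simp add: w_def v_def g1_def g2_def uadd uact uy uz act_simps algebra_simps flip: z_def)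
    have uuw: "u (u w) = act w (\<delta> * \<delta>) + act v \<delta> + u v"
      unfolding uw uadd uact by (simp add: uw act_simps)
    have uv: "u v = act x (a * g2) + act z (g1 + b * g2)"
      unfolding v_def uadd uact uz z_def[symmetric] by (simp add: act_simps algebra_simps)
    obtain k l m where 0: "act w k + act (u w) l + act (u (u w)) m = 0" and nz: "\<not> (k = 0 \<and> l = 0 \<and> m = 0)"
      using dep[of w] by blast
    define k' l' where "k' = k + \<delta> * l + \<delta> * \<delta> * m" and "l' = l + \<delta> * m"
    have 1: "act w k' + (act v l' + act (u v) m) = 0"
      using 0 unfolding uuw unfolding uw k'_def l'_def by (simp add: act_simps algebra_simps)
    have "k' = 0"
    proof -
      have "act x (\<alpha> * k' + g1 * l' + a * g2 * m) + act z (\<beta> * k' + g2 * l' + (g1 + b * g2) * m) + act y k' = 0"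
        using 1 unfolding uv unfolding w_def v_def by (simp add: act_simps algebra_simps)
      then show ?thesis using gi by blast
    qed
    with 1 have 2: "act (u v) m + act v l' = 0" by (simp add: add.commute)
    have "\<exists>q. u v = act v q"
    proof (cases "m = 0")
      case False
      have "act (u v) m = act v (- l')" using 2 by (simp add: act_minus_right eq_neg_iff_add_eq_0)
      then have "act (act (u v) m) (inverse m) = act (act v (- l')) (inverse m)" by simp
      then have "u v = act v (- l' * inverse m)" using False by (simp add: act_simps)
      then show ?thesis ..
    next
      case True
      then have "l' \<noteq> 0" using nz \<open>k' = 0\<close> by (auto simp: k'_def l'_def)
      then have "v = 0" using 2 True by (simp add: act_eq_0_iff)
      moreover have "u 0 = 0" using uadd[of 0 0] by simp
      ultimately show ?thesis by simp
    qed
    then show ?thesis unfolding v_def g1_def g2_def .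
  qed
  \<comment> \<open>Eliminating \<open>t\<close> from \<open>u p = p \<delta>\<close> with
    \<open>p = x t + z \<beta>\<close> leaves \<open>\<phi> \<beta> = 0\<close>. If only
    \<open>0\<close> solved this, \<open>\<phi>\<close> would be onto and
    \<open>u w - w \<delta>\<close> could be made equal to \<open>x\<close>, which is no
    eigenvector.\<close>
  define \<phi> where "\<phi> \<beta> = a * \<beta> + b * \<beta> * \<delta> - \<beta> * \<delta> * \<delta>" for \<beta>
  have "\<exists>r. r \<noteq> 0 \<and> \<phi> r = 0"
  proof (rule ccontr)
    assume none: "\<not> ?thesis"
    have "surj \<phi>"
    proof (rule injective_imp_surjective)
      show "\<phi> (v + w) = \<phi> v + \<phi> w" for v w by (simp add: \<phi>_def algebra_simps)
      show "\<phi> (c * w) = c * \<phi> w" if "c \<in> Z" for c w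
        by (simp add: \<phi>_def distrib_left right_diff_distrib mult.assoc
            Z_left_commute[OF that, of a] Z_left_commute[OF that, of b])
      show "w = 0" if "\<phi> w = 0" for w using none that by blast
    qed
    then obtain \<beta> where \<beta>: "\<phi> \<beta> = 1 - s1 - s2 * \<delta>" by (metis surjD)
    define \<alpha> where "\<alpha> = \<beta> * \<delta> - b * \<beta> - s2"
    have g1: "s1 + a * \<beta> - \<alpha> * \<delta> = 1"
      using \<beta> by (simp add: \<phi>_def \<alpha>_def algebra_simps)
    have g2: "s2 + \<alpha> + b * \<beta> - \<beta> * \<delta> = 0" by (simp add: \<alpha>_def)
    show False using ev[of \<beta> \<alpha>] x unfolding g1 g2 by (simp add: act_one)
  qed
  then obtain r where r: "r \<noteq> 0" and \<phi>r: "\<phi> r = 0" by blast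
  define t where "t = r * \<delta> - b * r"
  define p where "p = act x t + act z r"
  have ar: "a * r = t * \<delta>" using \<phi>r by (simp add: \<phi>_def t_def algebra_simps)
  have tr: "t + b * r = r * \<delta>" by (simp add: t_def)
  have up: "u p = act p \<delta>"
  proof -
    have "u p = act x (a * r) + act z (t + b * r)"
      unfolding p_def uadd uact uz z_def[symmetric] by (simp add: act_simps algebra_simps)
    then show ?thesis unfolding ar tr by (simp add: p_def act_simps)
  qed
  define \<epsilon> \<eta> where "\<epsilon> = inverse r" and "\<eta> = - t * inverse r"
  have zp: "z = act p \<epsilon> + act x \<eta>"
    using r by (simp add: p_def \<epsilon>_def \<eta>_def act_simps)
  define \<sigma> \<tau> where "\<sigma> = \<epsilon> * s2" and "\<tau> = s1 + \<eta> * s2"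
  have uy': "u y = act p \<sigma> + act x \<tau> + act y \<delta>"
    unfolding uy by (simp add: zp \<sigma>_def \<tau>_def act_simps algebra_simps)
  have basis: "is_basis act UNIV 3 ((!) [p, x, y])"
  proof (rule basis_3I[OF g])
    fix \<alpha> \<beta> \<gamma> assume "act p \<alpha> + act x \<beta> + act y \<gamma> = 0"
    then have "act x (t * \<alpha> + \<beta>) + act z (r * \<alpha>) + act y \<gamma> = 0"
      by (simp add: p_def act_simps algebra_simps)
    from gi[OF this] show "\<alpha> = 0 \<and> \<beta> = 0 \<and> \<gamma> = 0" using r by auto
  qed
  show ?thesis
  proof (rule triangular_case[OF u basis up _ uy'])
    show "u x = act p \<epsilon> + act x \<eta>" using zp by (simp add: z_def)
    show "\<exists>q. u (act p (\<sigma> + \<epsilon> * s + (\<delta> * r' - r' * \<delta>)) + act x (\<tau> + \<eta> * s - s * \<delta>)) =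
        act (act p (\<sigma> + \<epsilon> * s + (\<delta> * r' - r' * \<delta>)) + act x (\<tau> + \<eta> * s - s * \<delta>)) q" for r' s
    proof -
      \<comment> \<open>Coordinates of \<open>p r' + x s\<close> with respect to \<open>x\<close>
        and \<open>z\<close>, so that \<open>ev\<close> applies to
        \<open>w = y + p r' + x s\<close>.\<close>
      define \<alpha> \<beta> where "\<alpha> = t * r' + s" and "\<beta> = r * r'"
      let ?w = "act p r' + act x s"
      have w: "?w = act x \<alpha> + act z \<beta>"
        by (simp add: p_def \<alpha>_def \<beta>_def act_simps algebra_simps)
      have "u ?w = act p (\<delta> * r' + \<epsilon> * s) + act x (\<eta> * s)"
        by (simp add: uadd uact up zp act_simps algebra_simps flip: z_def)
      then have "act p (\<sigma> + \<epsilon> * s + (\<delta> * r' - r' * \<delta>)) + act x (\<tau> + \<eta> * s - s * \<delta>)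
          = (u y - act y \<delta>) + u ?w - act ?w \<delta>"
        unfolding uy' by (simp add: act_simps algebra_simps)
      also have "\<dots> = act x (s1 + a * \<beta> - \<alpha> * \<delta>) + act z (s2 + \<alpha> + b * \<beta> - \<beta> * \<delta>)"
        unfolding w uy uadd uact uz z_def[symmetric] by (simp add: act_simps algebra_simps)
      finally have eq: "act p (\<sigma> + \<epsilon> * s + (\<delta> * r' - r' * \<delta>)) + act x (\<tau> + \<eta> * s - s * \<delta>)
        = act x (s1 + a * \<beta> - \<alpha> * \<delta>) + act z (s2 + \<alpha> + b * \<beta> - \<beta> * \<delta>)" .
      show ?thesis unfolding eq by (rule ev)
    qed
  qed
qed simp

lemma trace_zero_imp_zero_diagonal:
  assumes M: "represented_by act u n e M" and n: "3 \<le> n" and u: "endomorphism act u"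
    and special: "\<not> special_type_I scale act u" "\<not> special_type_II scale act u"
      "\<not> special_type_III act u"
    and tr: "tq (\<Sum>i<n. M i i) = 0"
  shows "\<exists>f. zero_diagonal UNIV u n f"
proof (cases "u = (\<lambda>x. 0)")
  \<comment> \<open>The zero map is near scalar but satisfies the hypotheses, so it is treated
    apart.\<close>
  case True
  have "is_basis act UNIV n e" using M by (simp add: represented_by_def)
  then have "zero_diagonal UNIV u n e"
    unfolding zero_diagonal_def using True lc_zero[of n e] by (intro conjI allI impI exI[of _ "\<lambda>_. 0"]) auto
  then show ?thesis by blast
next
  case False
  have b: "is_basis act UNIV n e" using M by (simp add: represented_by_def)
  have r: "rep UNIV u n e M" and lin: "lin_on UNIV u" using M u by (simp_all add: rep_UNIV lin_on_UNIV)
  have "has_dim act UNIV n" using b by (auto simp: has_dim_def)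
  moreover have "2 \<le> n" using n by simp
  ultimately have ns: "\<not> near_scalar u"
    using near_scalar_special[OF u, of n] special False by blast
  show ?thesis
  proof (cases "n = 3")
    case True
    have "\<not> isotypic u" using isotypic_special_type_III[OF u] special False by blast
    then have "cyclic3 UNIV u" using not_cyclic3_special[of e u] b u ns True by auto
    then show ?thesis using cyclic3_zero_diagonal[OF n r lin] tr by blast
  next
    case False
    then have "4 \<le> n" using n by simp
    then show ?thesis
      using bicyclic_zero_diagonal[OF _ r lin] not_bicyclic_near_scalar[OF b _ u] ns tr by blast
  qed
qed

end

theorem theorem1p5:
  fixes scale :: "'f::field \<Rightarrow> 'q::division_ring \<Rightarrow> 'q"
    and act :: "'v::ab_group_add \<Rightarrow> 'q \<Rightarrow> 'v"
    and u :: "'v \<Rightarrow> 'v"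
    and n :: nat
  assumes "quaternion_division_algebra scale"
    and "right_vector_space act"
    and "has_dim act UNIV n"
    and "n \<ge> 3"
    and "endomorphism act u"
    and "\<not> special_type_I scale act u"
    and "\<not> special_type_II scale act u"
    and "\<not> special_type_III act u"
  shows "(endo_reduced_trace scale act u = 0 \<longleftrightarrow>
            (\<exists>e M. represented_by act u n e M \<and> (\<forall>i<n. M i i = 0))) \<and>
         (endo_reduced_trace scale act u = 0 \<longleftrightarrow>
            (\<exists>a b. endomorphism act a \<and> endomorphism act b \<and> nilpotent a \<and> nilpotent b \<and>
                   u = (\<lambda>x. a x + b x)))"
proof -
  interpret quaternion_division_algebra scale by fact
  interpret right_vector_space act by fact
  interpret quaternionic_space scale act ..
  let ?i = "endo_reduced_trace scale act u = 0"
  let ?ii = "\<exists>e M. represented_by act u n e M \<and> (\<forall>i<n. M i i = 0)"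
  let ?iii = "\<exists>a b. endomorphism act a \<and> endomorphism act b \<and> nilpotent a \<and> nilpotent b \<and>
                   u = (\<lambda>x. a x + b x)"
  note u = \<open>endomorphism act u\<close>
  obtain e where e: "is_basis act UNIV n e" using \<open>has_dim act UNIV n\<close> by (auto simp: has_dim_def)
  obtain M where M: "represented_by act u n e M"
    using rep_exists[OF e, of u] u by (auto simp: rep_UNIV lin_on_UNIV)
  have i_ii: ?ii if ?i
  proof -
    have "tq (\<Sum>i<n. M i i) = 0" using that endo_reduced_trace_eq[OF M u] by simp
    then obtain f where "zero_diagonal UNIV u n f"
      using trace_zero_imp_zero_diagonal[OF M] assms by blast
    then show ?thesis using zero_diagonal_rep rep_UNIV by blast
  qed
  have ii_iii: ?iii if ?ii
  proof -
    obtain e M where "rep UNIV u n e M" "\<And>i. i < n \<Longrightarrow> M i i = 0"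
      using \<open>?ii\<close> by (auto simp: rep_UNIV)
    then show ?thesis by (intro zero_diagonal_sum_nilpotent[OF _ u])
  qed
  have ii_i: ?i if ?ii
  proof -
    obtain e M where "represented_by act u n e M" "\<forall>i<n. M i i = 0" using \<open>?ii\<close> by blast
    then show ?thesis using endo_reduced_trace_eq[OF _ u] by (simp add: tq_on_Z Z_0)
  qed
  have iii_i: ?i if ?iii
  proof -
    \<comment> \<open>Both nilpotent summands are represented in the one basis \<open>e\<close>, so
      their matrices add up to one of \<open>u\<close>.\<close>
    have tr0: "\<exists>N. rep UNIV a n e N \<and> tq (\<Sum>i<n. N i i) = 0"
      if a: "endomorphism act a" "nilpotent a" for a
    proof -
      obtain N where N: "rep UNIV a n e N" using rep_exists[OF e] a(1) lin_on_UNIV by blast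
      obtain k where "a ^^ k = (\<lambda>x. 0)" using a(2) by (auto simp: nilpotent_def)
      then have "tq (\<Sum>i<n. N i i) = 0"
        using a(1) by (intro nilpotent_trace_zero[OF N, of k]) (simp_all add: lin_on_UNIV)
      with N show ?thesis by blast
    qed
    obtain a b where "endomorphism act a" "nilpotent a" "endomorphism act b" "nilpotent b"
      and uab: "u = (\<lambda>x. a x + b x)" using \<open>?iii\<close> by blast
    then obtain A B where A: "rep UNIV a n e A" "tq (\<Sum>i<n. A i i) = 0"
      and B: "rep UNIV b n e B" "tq (\<Sum>i<n. B i i) = 0" using tr0 by blast
    have "rep UNIV u n e (\<lambda>i j. A i j + B i j)"
      using A(1) B(1) by (simp add: rep_def uab lc_add)
    then have "endo_reduced_trace scale act u = tq (\<Sum>i<n. A i i + B i i)"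
      using endo_reduced_trace_eq[OF _ u] by (simp add: rep_UNIV)
    also have "\<dots> = 0" using A(2) B(2) by (simp add: sum.distrib tq_add)
    finally show ?thesis .
  qed
  show ?thesis using i_ii ii_iii ii_i iii_i by blast
qed

end
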